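(* Let $M\in\mathbb{N}$, $M\ge1$, let $c\in\mathbb{C}$ with $|c|=1$, and let $\phi\in\mathbb{C}\{t\}$ with $\phi(t)=it^{2M}+o(t^{2M})$ be such that $$t\mapsto(ct^M,\phi(t))$$ is an injective parametrization of an analytic curve that avoids $U_2$ for $t\in\mathbb{C}$ small. Then there exists $L(s)\in\mathbb{C}\{s\}$ with $L(0)=0$ such that this curve can be parametrized near $(0,0)$ by $$s\mapsto\left(cs^Me^{ML(s)},\ is^{2M}+2Mi\int_{[0,s]}w^{2M}L'(w)\,dw\right).\qquad( * )$$ Furthermore, the curve falls into exactly one of two distinct types: (1) (curve type) $M=1$ and $L(s)\in i\mathbb{R}\{s\}$, in which case the curve intersects $\partial U_2$ along a real one-dimensional curve. (2) (isolated type) $M\ge1$ and $L(s)$ has the form $$L(s)=iA_0(s^M)+s^{2MK}L_1(s)$$ where $K\in\mathbb{N}$, $K\geq 1$, $A_0(s)\in\mathbb{R}[s]$ has degree less than $2K$, and $L_1\in\mathbb{C}\{s\}$ satisfies $\Re(L_1(0))>0$. In this case the curve intersects $\partial U_2$ at the isolated point $(0,0)$. Conversely, given $M\ge1$, $|c|=1$ and $L(s)\in\mathbb{C}\{s\}$ with $L(0)=0$ satisfying either of the two conditions ($M=1$ and $L\in i\mathbb{R}\{s\}$; or $M\ge 1$ and $L=iA_0(s^M)+s^{2MK}L_1(s)$ with $K,A_0,L_1$ as in (2)), the parametrization $( * )$ yields an analytic curve that avoids $U_2$ near $(0,0)$, i.e. for all small $s\in\mathbb{C}$ the point in $( * )$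 is not in $U_2$. Moreover, when $M\ge2$, if the parametrization $( * )$ is injective for small $s$, then $L$ is not a function of $s^M$ (i.e. $L$ is not of the form $L(s)=\tilde L(s^M)$ with $\tilde L\in\mathbb{C}\{s\}$).
   Context: $U_2=\{(z,w)\in\mathbb{C}^2:\Im w>|z|^2\}$, with boundary $\partial U_2=\{\Im w=|z|^2\}$. $\mathbb{C}\{s\}$ is the ring of convergent power series centered at $0$; $i\mathbb{R}\{s\}$ is the set of convergent power series all of whose coefficients are purely imaginary. $\int_{[0,s]}$ is the integral along the segment from $0$ to $s\in\mathbb{C}$. "Avoids $U_2$ for $t$ small" means that $(ct^M,\phi(t))\notin U_2$ for all $t\in\mathbb{C}$ in some neighborhood of $0$; equivalently $|t|^{2M}\ge\Im\phi(t)$ there. "Injective" means injective for $t$ in a neighborhood of $0$. "Can be parametrized by" means that $( * )$ is an analytic parametrization, for $s\in\mathbb{C}$ near $0$, of the same germ of analytic curve at $(0,0)$. *)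

theory Defs
  imports "HOL-Complex_Analysis.Complex_Analysis" "HOL-Library.Landau_Symbols"
begin

text \<open>
  A power series at 0 is an element of \<^typ>\<open>complex fps\<close>; its sum is \<^const>\<open>eval_fps\<close>, which is only
  meaningful inside the disc of convergence. All statements below about sums are local at 0.
\<close>

definition convergent_series :: "complex fps set" where
  "convergent_series = {L. fps_conv_radius L > 0}"

definition imaginary_series :: "complex fps set" where
  "imaginary_series = {L \<in> convergent_series. \<forall>n. Re (fps_nth L n) = 0}"

definition U2 :: "(complex \<times> complex) set" where
  "U2 = {(z, w). Im w > (cmod z)\<^sup>2}"

lemma frontier_U2: "frontier U2 = {(z, w). Im w = (cmod z)\<^sup>2}"
proof -
  have U2_eq: "U2 = {p. (cmod (fst p))\<^sup>2 < Im (snd p)}"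
    by (auto simp: U2_def)
  have "open U2"
    unfolding U2_eq by (intro open_Collect_less continuous_intros)
  moreover have "closure U2 = {p. (cmod (fst p))\<^sup>2 \<le> Im (snd p)}"
  proof
    have "closed {p :: complex \<times> complex. (cmod (fst p))\<^sup>2 \<le> Im (snd p)}"
      by (intro closed_Collect_le continuous_intros)
    then show "closure U2 \<subseteq> {p. (cmod (fst p))\<^sup>2 \<le> Im (snd p)}"
      by (rule closure_minimal[rotated]) (auto simp: U2_eq)
  next
    show "{p. (cmod (fst p))\<^sup>2 \<le> Im (snd p)} \<subseteq> closure U2"
    proof
      fix p :: "complex \<times> complex"
      assume p: "p \<in> {p. (cmod (fst p))\<^sup>2 \<le> Im (snd p)}"
      define e where "e n = inverse (real (Suc n))" for n
      define q where "q n = (fst p, snd p + \<i> * complex_of_real (e n))" for n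
      have "(\<lambda>n. complex_of_real (e n)) \<longlonglongrightarrow> complex_of_real 0"
        unfolding e_def by (intro tendsto_of_real LIMSEQ_inverse_real_of_nat)
      then have "q \<longlonglongrightarrow> (fst p, snd p + \<i> * complex_of_real 0)"
        unfolding q_def by (rule tendsto_Pair[OF tendsto_const
            tendsto_add[OF tendsto_const tendsto_mult[OF tendsto_const]]])
      moreover have "q n \<in> U2" for n
      proof -
        have "e n > 0" by (simp add: e_def)
        then show ?thesis using p by (simp add: U2_eq q_def)
      qed
      ultimately show "p \<in> closure U2"
        unfolding closure_sequential by (intro exI[of _ q]) simp
    qed
  qed
  ultimately have "frontier U2 = {p. (cmod (fst p))\<^sup>2 \<le> Im (snd p)} - U2"
    by (simp only: frontier_def interior_open)
  also have "\<dots> = {(z, w). Im w = (cmod z)\<^sup>2}"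
    unfolding U2_eq by (force simp: not_less)
  finally show ?thesis .
qed

definition star_param :: "nat \<Rightarrow> complex \<Rightarrow> complex fps \<Rightarrow> complex \<Rightarrow> complex \<times> complex" where
  "star_param M c L s =
     (c * s ^ M * exp (of_nat M * eval_fps L s),
      \<i> * s ^ (2 * M) + 2 * of_nat M * \<i> *
        contour_integral (linepath 0 s) (\<lambda>w. w ^ (2 * M) * eval_fps (fps_deriv L) w))"

definition avoids_U2 :: "(complex \<Rightarrow> complex \<times> complex) \<Rightarrow> bool" where
  "avoids_U2 f \<longleftrightarrow> (\<forall>\<^sub>F t in nhds 0. f t \<notin> U2)"

definition locally_injective :: "(complex \<Rightarrow> complex \<times> complex) \<Rightarrow> bool" where
  "locally_injective f \<longleftrightarrow> (\<exists>r>0. inj_on f (ball 0 r))"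

text \<open>Equality of the set germs at (0,0) of the images of all small discs.\<close>

definition same_curve_germ ::
    "(complex \<Rightarrow> complex \<times> complex) \<Rightarrow> (complex \<Rightarrow> complex \<times> complex) \<Rightarrow> bool" where
  "same_curve_germ f g \<longleftrightarrow>
     (\<exists>r>0. \<forall>a b. 0 < a \<and> a \<le> r \<and> 0 < b \<and> b \<le> r \<longrightarrow>
        (\<forall>\<^sub>F p in nhds (0, 0). p \<in> f ` ball 0 a \<longleftrightarrow> p \<in> g ` ball 0 b))"

text \<open>
  Near \<open>p\<close>, the set \<open>S\<close> is a regular real-analytic arc through \<open>p\<close>: the components of the arc are
  the restrictions to the reals of convergent power series with complex coefficients. The
  parameter interval is compact so that the arc cannot return to \<open>p\<close> at its ends.
\<close>

definition real_curve_near :: "(complex \<times> complex) set \<Rightarrow> complex \<times> complex \<Rightarrow> bool" where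
  "real_curve_near S p \<longleftrightarrow>
     (\<exists>G H (e::real). e > 0 \<and> ereal e < fps_conv_radius G \<and> ereal e < fps_conv_radius H \<and>
        (let \<gamma> = (\<lambda>x::real. (eval_fps G (of_real x), eval_fps H (of_real x)));
             \<gamma>' = (\<lambda>x::real. (eval_fps (fps_deriv G) (of_real x), eval_fps (fps_deriv H) (of_real x)))
         in \<gamma> 0 = p \<and> inj_on \<gamma> {-e..e} \<and> (\<forall>x\<in>{-e..e}. \<gamma>' x \<noteq> (0, 0)) \<and>
            (\<forall>\<^sub>F q in nhds p. q \<in> S \<longleftrightarrow> q \<in> \<gamma> ` {-e..e})))"

definition meets_boundary_in_real_curve :: "(complex \<Rightarrow> complex \<times> complex) \<Rightarrow> bool" where
  "meets_boundary_in_real_curve f \<longleftrightarrow>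
     (\<exists>r>0. \<forall>a. 0 < a \<and> a \<le> r \<longrightarrow> real_curve_near (f ` ball 0 a \<inter> frontier U2) (0, 0))"

definition meets_boundary_in_isolated_point :: "(complex \<Rightarrow> complex \<times> complex) \<Rightarrow> bool" where
  "meets_boundary_in_isolated_point f \<longleftrightarrow> (\<exists>r>0. f ` ball 0 r \<inter> frontier U2 = {(0, 0)})"

definition curve_type :: "nat \<Rightarrow> complex fps \<Rightarrow> bool" where
  "curve_type M L \<longleftrightarrow> M = 1 \<and> L \<in> imaginary_series"

definition isolated_type :: "nat \<Rightarrow> complex fps \<Rightarrow> bool" where
  "isolated_type M L \<longleftrightarrow> M \<ge> 1 \<and>
     (\<exists>(K::nat) (A0 :: real poly) L1. K \<ge> 1 \<and> degree A0 < 2 * K \<and>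
        L1 \<in> convergent_series \<and> Re (fps_nth L1 0) > 0 \<and>
        L = fps_const \<i> * (fps_of_poly (map_poly complex_of_real A0) oo fps_X ^ M)
            + fps_X ^ (2 * M * K) * L1)"

end

theory Submission
  imports Defs
begin

text \<open>
  Put \<open>T s = s exp (L s)\<close>, so that the curve is \<open>s \<mapsto> (c T(s)\<^sup>M, i \<psi>(s))\<close> with \<open>s \<psi>' = 2 M s\<^bsup>2M\<^esup> (1 + s L')\<close>.
  It avoids \<open>U2\<close> iff the defect \<open>cmod (T s)\<^bsup>2M\<^esup> - Re (\<psi> s)\<close> is nonnegative. On a circle \<open>cmod (T s) = const\<close>
  the minimum of the defect is attained where \<open>s\<^bsup>2M\<^esup> > 0\<close>, so only the \<open>2M\<close> rays through the
  \<open>2M\<close>-th roots of unity \<open>\<zeta>\<close> matter; there the sign of the defect is the sign of the first nonzero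
  number \<open>Re (a\<^sub>n \<zeta>\<^sup>n)\<close>, where \<open>L = \<Sum> a\<^sub>n s\<^sup>n\<close>. Averaging over \<open>\<zeta>\<close>, nonnegativity on all rays forces this first
  index to be a multiple \<open>2MK\<close>, which is the isolated type; if there is no such index,
  \<open>L\<close> is an imaginary series in \<open>s\<^sup>M\<close>, and injectivity leaves only \<open>M = 1\<close>, the curve type.
\<close>

text \<open>\<open>star_param\<close> is built so that both coordinates have derivatives with the
  same factor: T' = exp(L) (1 + s L') and psi' = 2M s^(2M-1) (1 + s L'). On a ray through a 2M-th
  root of unity the derivative of the defect is therefore 2M r^(2M-1) times the positive number Re
  (1 + s L') times exp (2M Re L) - 1. The integral is never evaluated or expanded: monotonicity
  along rays replaces it. Two obstacles shape the rest. On a circle, the height is also critical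
  where s^(2M) < 0; no second derivative is needed to discard these points, because Re psi is
  negative there and the defect positive outright. Moreover, equality of germs is equality of sets,
  and the dichotomy concerns every \<open>L\<close> with the given germ. There is then no change of
  parameter between t and s at hand, so facts about one parametrization are carried to the other
  through points of the image, by properness and by rotations of the parameter.\<close>

section \<open>Radial and height coordinates of the curve\<close>

definition star_radial :: "complex fps \<Rightarrow> complex \<Rightarrow> complex" where
  "star_radial L s = s * exp (eval_fps L s)"

definition star_height :: "nat \<Rightarrow> complex fps \<Rightarrow> complex \<Rightarrow> complex" where
  "star_height M L s = s ^ (2 * M) + 2 * of_nat M *
     contour_integral (linepath 0 s) (\<lambda>w. w ^ (2 * M) * eval_fps (fps_deriv L) w)"

definition defect :: "nat \<Rightarrow> complex fps \<Rightarrow> complex \<Rightarrow> real" where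
  "defect M L s = cmod (star_radial L s) ^ (2 * M) - Re (star_height M L s)"

lemma star_param_eq:
  "star_param M c L s = (c * star_radial L s ^ M, \<i> * star_height M L s)"
  by (simp add: star_param_def star_radial_def star_height_def power_mult_distrib
      exp_of_nat_mult mult.assoc distrib_left)

lemma defect_eq_U2_defining_function:
  assumes "cmod c = 1"
  shows "(cmod (fst (star_param M c L s)))\<^sup>2 - Im (snd (star_param M c L s)) = defect M L s"
  using assms by (simp add: star_param_eq defect_def norm_mult norm_power power_even_eq)

lemma star_param_notin_U2_iff:
  assumes "cmod c = 1"
  shows "star_param M c L s \<notin> U2 \<longleftrightarrow> defect M L s \<ge> 0"
  using defect_eq_U2_defining_function[OF assms, of M L s] by (auto simp: U2_def case_prod_beta)

lemma star_param_in_frontier_iff: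
  assumes "cmod c = 1"
  shows "star_param M c L s \<in> frontier U2 \<longleftrightarrow> defect M L s = 0"
  using defect_eq_U2_defining_function[OF assms, of M L s] by (auto simp: frontier_U2 case_prod_beta)

lemma star_radial_0 [simp]: "star_radial L 0 = 0"
  by (simp add: star_radial_def)

lemma star_height_0 [simp]: "M \<ge> 1 \<Longrightarrow> star_height M L 0 = 0"
  by (simp add: star_height_def)

lemma star_radial_eq_0_iff [simp]: "star_radial L s = 0 \<longleftrightarrow> s = 0"
  by (simp add: star_radial_def)

lemma eventually_in_disc_of_convergence:
  fixes L :: "complex fps"
  assumes "fps_conv_radius L > 0"
  shows "eventually (\<lambda>s::complex. ereal (norm s) < fps_conv_radius L) (nhds 0)"
proof -
  have "eventually (\<lambda>s::complex. s \<in> eball 0 (fps_conv_radius L)) (nhds 0)"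
    using assms by (intro eventually_nhds_in_open) (auto simp: zero_ereal_def)
  then show ?thesis by (simp add: dist_0_norm)
qed

lemma convergent_radius_obtain:
  fixes L :: "complex fps"
  assumes "fps_conv_radius L > 0"
  obtains R where "R > 0" "\<And>s::complex. norm s < R \<Longrightarrow> ereal (norm s) < fps_conv_radius L"
  using eventually_in_disc_of_convergence[OF assms] unfolding eventually_nhds_metric
  by (auto simp: dist_norm)

lemma star_height_deriv:
  fixes L :: "complex fps"
  assumes "ereal (norm s) < fps_conv_radius L" "M \<ge> 1"
  shows "(star_height M L has_field_derivative
           2 * of_nat M * s ^ (2 * M - 1) * (1 + s * eval_fps (fps_deriv L) s)) (at s)"
proof -
  define f where "f = (\<lambda>w. w ^ (2 * M) * eval_fps (fps_deriv L) w)"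
  \<comment> \<open>The radius of convergence may be infinite; a finite \<open>R\<close> beyond
    \<open>norm s\<close> gives a disc, whose convexity supplies the primitive
    \<open>P\<close>.\<close>
  obtain R where R: "norm s < R" "ereal R < fps_conv_radius L"
    using ereal_dense2[OF assms(1)] by (metis ereal_less_eq(3) less_ereal.simps(1) not_less)
  have Rp: "R > 0" using R(1) norm_ge_zero[of s] by linarith
  have "ball 0 R \<subseteq> eball 0 (fps_conv_radius (fps_deriv L))"
    using R(2) fps_conv_radius_deriv[of L] by (intro ball_eball_mono) auto
  then have hol: "f holomorphic_on ball 0 R"
    unfolding f_def by (intro holomorphic_intros) auto
  obtain P where P: "\<And>x. x \<in> ball 0 R \<Longrightarrow> (P has_field_derivative f x) (at x)"
    using holomorphic_convex_primitive'[OF _ _ hol] at_within_open[OF _ open_ball]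
    by (metis convex_ball open_ball)
  have eq: "contour_integral (linepath 0 x) f = P x - P 0" if "x \<in> ball 0 R" for x
  proof -
    have "(f has_contour_integral P (pathfinish (linepath 0 x)) - P (pathstart (linepath 0 x))) (linepath 0 x)"
    proof (rule contour_integral_primitive)
      show "(P has_field_derivative f y) (at y within ball 0 R)" if "y \<in> ball 0 R" for y
        using P[OF that] has_field_derivative_at_within by blast
      show "path_image (linepath 0 x) \<subseteq> ball 0 R"
        using that Rp by (simp add: closed_segment_subset)
    qed (rule valid_path_linepath)
    then show ?thesis by (simp add: contour_integral_unique)
  qed
  have sR: "s \<in> ball 0 R" using R by simp
  have "((\<lambda>x. x ^ (2 * M) + 2 * of_nat M * (P x - P 0)) has_field_derivative
      (of_nat (2 * M) * s ^ (2 * M - 1) + 2 * of_nat M * f s)) (at s)"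
    by (intro DERIV_add DERIV_cmult) (auto intro!: derivative_eq_intros P[OF sR])
  also have "of_nat (2 * M) * s ^ (2 * M - 1) + 2 * of_nat M * f s =
      2 * of_nat M * s ^ (2 * M - 1) * (1 + s * eval_fps (fps_deriv L) s)"
    using power_minus_mult[of "2 * M" s] assms(2) by (simp add: f_def algebra_simps)
  finally show ?thesis
    by (rule has_field_derivative_transform_within_open[OF _ open_ball sR])
       (simp add: star_height_def eq flip: f_def)
qed

lemma eval_fps_deriv_at:
  fixes L :: "complex fps"
  assumes "ereal (norm s) < fps_conv_radius L"
  shows "(eval_fps L has_field_derivative eval_fps (fps_deriv L) s) (at s)"
  using assms by (intro has_field_derivative_eval_fps) auto

text \<open>The factor \<open>1 + s L'\<close> is the one in the derivative of the height, so it
  cancels when the height is differentiated with respect to T.\<close>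

lemma star_radial_deriv:
  fixes L :: "complex fps"
  assumes "ereal (norm s) < fps_conv_radius L"
  shows "(star_radial L has_field_derivative
           exp (eval_fps L s) * (1 + s * eval_fps (fps_deriv L) s)) (at s)"
proof -
  have "((\<lambda>s. s * exp (eval_fps L s)) has_field_derivative
      1 * exp (eval_fps L s) + (exp (eval_fps L s) * eval_fps (fps_deriv L) s) * s) (at s)"
    by (intro DERIV_mult DERIV_ident DERIV_chain2[OF DERIV_exp] eval_fps_deriv_at assms)
  then show ?thesis
    by (simp add: star_radial_def[abs_def] algebra_simps)
qed

section \<open>Local inverses\<close>

text \<open>Two discs are kept apart: \<open>g (f z) = z\<close> holds on all of
  \<open>ball 0 R\<close>, even where \<open>f z\<close> leaves \<open>ball 0 \<rho>\<close>, while
  \<open>f (g q) = q\<close> is claimed on \<open>ball 0 \<rho>\<close>. The bound \<open>R0\<close>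
  lets the parameter disc be shrunk in advance.\<close>

lemma holomorphic_local_inverse:
  assumes "f holomorphic_on ball 0 R0" "R0 > 0" "f 0 = 0" "deriv f 0 \<noteq> 0"
  obtains R \<rho> g where "0 < R" "R \<le> R0" "inj_on f (ball 0 R)" "\<rho> > 0" 
    "g holomorphic_on ball 0 \<rho>" "\<And>q. q \<in> ball 0 \<rho> \<Longrightarrow> g q \<in> ball 0 R \<and> f (g q) = q"
    "\<And>z. z \<in> ball 0 R \<Longrightarrow> g (f z) = z"
    "\<And>q. q \<in> ball 0 \<rho> \<Longrightarrow> deriv f (g q) * deriv g q = 1"
proof -
  obtain r where r: "r > 0" "ball (0::complex) r \<subseteq> ball 0 R0" "open (f ` ball 0 r)" "inj_on f (ball 0 r)"
    by (rule has_complex_derivative_locally_invertible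
      [OF assms(1) centre_in_ball[THEN iffD2, OF assms(2)] open_ball assms(4)]) (rule that)
  define R where "R = min r R0"
  have RR: "0 < R" "R \<le> R0" "R \<le> r" using r assms by (auto simp: R_def)
  have inj: "inj_on f (ball 0 R)"
    using r(4) RR by (meson inj_on_subset subset_ball)
  have hol: "f holomorphic_on ball 0 R"
    using assms(1) RR by (meson holomorphic_on_subset subset_ball)
  obtain g where g: "g holomorphic_on (f ` ball 0 R)"
      "\<And>z. z \<in> ball 0 R \<Longrightarrow> deriv f z * deriv g (f z) = 1" "\<And>z. z \<in> ball 0 R \<Longrightarrow> g (f z) = z"
    by (rule holomorphic_has_inverse[OF hol open_ball inj]) (rule that)
  have "open (f ` ball 0 R)" using open_mapping_thm3[OF hol open_ball inj] .
  moreover have "0 \<in> f ` ball 0 R" using RR(1) assms(3) by (auto intro!: image_eqI[of _ _ 0])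
  ultimately obtain \<rho> where \<rho>: "\<rho> > 0" "ball 0 \<rho> \<subseteq> f ` ball 0 R"
    by (meson open_contains_ball)
  show ?thesis
  proof (rule that[of R \<rho> g])
    show "g holomorphic_on ball 0 \<rho>" using g(1) \<rho>(2) holomorphic_on_subset by blast
    fix q :: complex assume "q \<in> ball 0 \<rho>"
    then obtain z where z: "z \<in> ball 0 R" "q = f z" using \<rho>(2) by blast
    have "g q = z" using g(3)[OF z(1)] z(2) by simp
    with z g(2)[OF z(1)] show "g q \<in> ball 0 R \<and> f (g q) = q" "deriv f (g q) * deriv g q = 1"
      by (metis)+
  qed (fact RR inj \<rho>(1) g(3))+
qed

lemma star_radial_local_inverse:
  fixes L :: "complex fps"
  assumes "fps_conv_radius L > 0" "R0 > 0"
  obtains R \<rho> g where "0 < R" "R \<le> R0" "inj_on (star_radial L) (ball 0 R)" "\<rho> > 0" 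
    "\<And>s::complex. s \<in> ball 0 R \<Longrightarrow> ereal (norm s) < fps_conv_radius L"
    "g holomorphic_on ball 0 \<rho>" "\<And>q. q \<in> ball 0 \<rho> \<Longrightarrow> g q \<in> ball 0 R \<and> star_radial L (g q) = q"
    "\<And>z. z \<in> ball 0 R \<Longrightarrow> g (star_radial L z) = z"
    "\<And>q. q \<in> ball 0 \<rho> \<Longrightarrow> deriv (star_radial L) (g q) * deriv g q = 1"
proof -
  obtain r where r: "r > 0" "\<And>s::complex. norm s < r \<Longrightarrow> ereal (norm s) < fps_conv_radius L"
    using convergent_radius_obtain[OF assms(1)] by blast
  define r' where "r' = min r R0"
  have r': "r' > 0" using r assms by (simp add: r'_def)
  have hol: "star_radial L holomorphic_on ball 0 r'"
    unfolding holomorphic_on_open[OF open_ball] 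
    using star_radial_deriv[OF r(2)] by (fastforce simp: r'_def)
  have d0: "deriv (star_radial L) 0 \<noteq> 0"
    using DERIV_imp_deriv[OF star_radial_deriv[of 0 L]] assms by (simp add: zero_ereal_def)
  show ?thesis
  proof (rule holomorphic_local_inverse[OF hol r' star_radial_0 d0], goal_cases)
    case (1 R \<rho> g)
    note g = this
    show ?thesis
    proof (rule that[OF g(1) _ g(3,4) _ g(5-8)])
      show "R \<le> R0" using g(2) by (simp add: r'_def)
      show "ereal (norm s) < fps_conv_radius L" if "s \<in> ball 0 R" for s :: complex
        using g(2) r(2) that by (simp add: r'_def)
    qed
  qed
qed

section \<open>Critical points of the height on circles\<close>

lemma has_real_derivative_Re_of_real:
  assumes "(h has_field_derivative D) (at (complex_of_real x))"
  shows "((\<lambda>x. Re (h (of_real x))) has_real_derivative Re D) (at x)"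
proof -
  have "((\<lambda>x. h (of_real x)) has_vector_derivative D) (at x)"
    using assms by (rule has_vector_derivative_real_field)
  then show ?thesis
    unfolding has_real_derivative_iff_has_vector_derivative
    by (rule bounded_linear.has_vector_derivative[OF bounded_linear_Re])
qed

text \<open>In the coordinate \<open>q = T s\<close>, where \<open>T s = s exp (L s)\<close>, the height \<open>\<psi>\<close> satisfies
  \<open>q d\<psi>/dq = 2 M s\<^bsup>2M\<^esup>\<close>; its real part is therefore critical on a circle \<open>cmod q = const\<close>
  exactly where \<open>s\<^bsup>2M\<^esup>\<close> is real.\<close>

lemma local_max_on_circle_imp_real_power:
  assumes conv: "fps_conv_radius L > 0" and M: "M \<ge> 1"
  shows "\<forall>\<^sub>F s0 in nhds 0.
    (\<forall>\<^sub>F s in nhds s0. cmod (star_radial L s) = cmod (star_radial L s0) \<longrightarrow>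
        Re (star_height M L s) \<le> Re (star_height M L s0)) \<longrightarrow> Im (s0 ^ (2 * M)) = 0"
proof (rule star_radial_local_inverse[OF conv zero_less_one], goal_cases)
  case (1 R \<rho> g)
  note inv = this
  have cont: "isCont (star_radial L) 0"
    using star_radial_deriv[of 0 L] conv DERIV_isCont by (auto simp: zero_ereal_def)
  have "\<forall>\<^sub>F s in nhds 0. star_radial L s \<in> ball 0 \<rho>"
    using cont inv(4) by (intro topological_tendstoD[of _ "0::complex"])
      (auto simp: isCont_def tendsto_nhds_iff)
  moreover have "\<forall>\<^sub>F s in nhds (0::complex). s \<in> ball 0 R"
    using inv(1) by (intro eventually_nhds_in_open) auto
  ultimately show ?case
  proof eventually_elim
    case (elim s0)
    show ?case
    proof
      assume max: "\<forall>\<^sub>F s in nhds s0. cmod (star_radial L s) = cmod (star_radial L s0) \<longrightarrow>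
          Re (star_height M L s) \<le> Re (star_height M L s0)"
      define q0 where "q0 = star_radial L s0"
      have q0: "q0 \<in> ball 0 \<rho>" and s0: "s0 \<in> ball 0 R" using elim by (auto simp: q0_def)
      have gq0: "g q0 = s0" using inv(8)[OF s0] by (simp add: q0_def)
      have gd: "(g has_field_derivative deriv g q0) (at q0)"
        using inv(6) q0 by (simp add: holomorphic_derivI)
      have d: "exp (eval_fps L s0) * (1 + s0 * eval_fps (fps_deriv L) s0) * deriv g q0 = 1"
        using inv(9)[OF q0] DERIV_imp_deriv[OF star_radial_deriv[OF inv(5)[OF s0]]] by (simp add: gq0)
      \<comment> \<open>\<open>h\<close> follows the height along the circle through
        \<open>q0\<close>. The angle is complex to keep the chain rule holomorphic; real angles stay
        on the circle.\<close>
      define h where "h \<theta> = star_height M L (g (q0 * exp (\<i> * \<theta>)))" for \<theta>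
      let ?D = "2 * of_nat M * s0 ^ (2 * M - 1) * (1 + s0 * eval_fps (fps_deriv L) s0) *
              (deriv g q0 * (q0 * (exp (\<i> * 0) * (\<i> * 1))))"
      have "((\<lambda>\<theta>. q0 * exp (\<i> * \<theta>)) has_field_derivative q0 * (exp (\<i> * 0) * (\<i> * 1))) (at 0)"
        by (intro DERIV_cmult DERIV_chain2[OF DERIV_exp] DERIV_ident)
      then have dg: "((\<lambda>\<theta>. g (q0 * exp (\<i> * \<theta>))) has_field_derivative
          deriv g q0 * (q0 * (exp (\<i> * 0) * (\<i> * 1)))) (at 0)"
        by (rule DERIV_chain2[rotated]) (simp add: gd)
      have "(h has_field_derivative ?D) (at 0)"
        unfolding h_def
        by (rule DERIV_chain2[OF _ dg]) (use star_height_deriv[OF inv(5)[OF s0] M] in \<open>simp add: gq0\<close>)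
      \<comment> \<open>The regrouping isolates T'(s0) g'(q0), which is 1 by \<open>d\<close>. What
        remains is 2M i s0^(2M), whose real part is -2M Im (s0^(2M)).\<close>
      also have "?D = 2 * of_nat M * (s0 ^ (2 * M - 1) * s0) * \<i> *
          (exp (eval_fps L s0) * (1 + s0 * eval_fps (fps_deriv L) s0) * deriv g q0)"
        by (simp add: q0_def star_radial_def algebra_simps)
      also have "\<dots> = 2 * of_nat M * s0 ^ (2 * M) * \<i>"
        using power_minus_mult[of "2 * M" s0] M by (simp add: d)
      finally have "((\<lambda>x. Re (h (of_real x))) has_real_derivative Re (2 * of_nat M * s0 ^ (2 * M) * \<i>)) (at 0)"
        by (intro has_real_derivative_Re_of_real) simp
      moreover
      have "isCont (\<lambda>x::real. g (q0 * exp (\<i> * of_real x))) 0"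
      proof (rule isCont_o2[of _ _ "\<lambda>\<theta>. g (q0 * exp (\<i> * \<theta>))"])
        show "isCont complex_of_real 0" by simp
        show "isCont (\<lambda>\<theta>. g (q0 * exp (\<i> * \<theta>))) (complex_of_real 0)"
          using DERIV_isCont[OF dg] by simp
      qed
      then have lim: "filterlim (\<lambda>x::real. g (q0 * exp (\<i> * of_real x))) (nhds s0) (nhds 0)"
        by (simp add: isCont_def tendsto_nhds_iff gq0)
      from eventually_compose_filterlim[OF max lim]
      obtain e where e: "e > 0" "\<And>x::real. \<bar>x\<bar> < e \<Longrightarrow>
          cmod (star_radial L (g (q0 * exp (\<i> * of_real x)))) = cmod (star_radial L s0) \<longrightarrow>
          Re (star_height M L (g (q0 * exp (\<i> * of_real x)))) \<le> Re (star_height M L s0)"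
        unfolding eventually_nhds_metric by (auto simp: dist_norm)
      have "Re (h (of_real y)) \<le> Re (h (of_real 0))" if "\<bar>0 - y\<bar> < e" for y
      proof -
        have "q0 * exp (\<i> * of_real y) \<in> ball 0 \<rho>" using q0 by (simp add: norm_mult)
        then have "cmod (star_radial L (g (q0 * exp (\<i> * of_real y)))) = cmod (star_radial L s0)"
          using inv(7) by (simp add: norm_mult q0_def)
        with e(2)[of y] that show ?thesis by (simp add: h_def gq0)
      qed
      ultimately have "Re (2 * of_nat M * s0 ^ (2 * M) * \<i>) = 0"
        using DERIV_local_max e(1) by blast
      then show "Im (s0 ^ (2 * M)) = 0" using M by simp
    qed
  qed
qed

section \<open>The defect along rays\<close>

text \<open>With T = \<open>star_radial L\<close>, the function \<open>1 + s L'\<close> is s T' / T.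
  Keeping \<open>s L'\<close> below 1 in modulus makes its real part positive, so it never affects
  the sign of a derivative along a ray.\<close>

lemma small_log_derivative:
  fixes L :: "complex fps"
  assumes conv: "fps_conv_radius L > 0"
  obtains \<delta> where "\<delta> > 0" "\<And>s::complex. norm s < \<delta> \<Longrightarrow> ereal (norm s) < fps_conv_radius L"
    "\<And>s::complex. norm s < \<delta> \<Longrightarrow> norm (s * eval_fps (fps_deriv L) s) < 1"
proof -
  have "0 < fps_conv_radius (fps_deriv L)"
    using conv fps_conv_radius_deriv[of L] by (rule less_le_trans)
  then have "isCont (\<lambda>s. s * eval_fps (fps_deriv L) s) 0"
    by (intro continuous_intros) (auto simp: zero_ereal_def)
  then have "\<forall>\<^sub>F s in nhds 0. s * eval_fps (fps_deriv L) s \<in> ball 0 1"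
    by (intro topological_tendstoD[of _ "0::complex"])
       (auto simp: isCont_def tendsto_nhds_iff)
  then have "\<forall>\<^sub>F s in nhds 0. norm (s * eval_fps (fps_deriv L) s) < 1 \<and> ereal (norm s) < fps_conv_radius L"
    using eventually_in_disc_of_convergence[OF conv] by eventually_elim simp
  then show ?thesis
    using that unfolding eventually_nhds_metric by (auto simp: dist_norm)
qed

text \<open>One formula for both kinds of critical rays: \<open>\<sigma> = 1\<close> where the
  defect has to be studied, \<open>\<sigma> < 0\<close> where it is positive anyway.\<close>

lemma star_height_ray_deriv:
  fixes L :: "complex fps"
  assumes "ereal \<bar>r\<bar> < fps_conv_radius L" "M \<ge> 1" "norm z = 1" "z ^ (2 * M) = of_real \<sigma>"
  shows "((\<lambda>r. Re (star_height M L (of_real r * z))) has_real_derivative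
     \<sigma> * (2 * real M * r ^ (2 * M - 1) * (1 + r * Re (z * eval_fps (fps_deriv L) (of_real r * z))))) (at r)"
proof -
  let ?s = "complex_of_real r * z"
  let ?L' = "eval_fps (fps_deriv L) ?s"
  have "((\<lambda>x. star_height M L (x * z)) has_field_derivative
     2 * of_nat M * ?s ^ (2 * M - 1) * (1 + ?s * ?L') * (1 * z)) (at (of_real r))"
    by (intro DERIV_chain2[where f = "star_height M L"] star_height_deriv DERIV_cmult_right DERIV_ident)
       (use assms in \<open>auto simp: norm_mult\<close>)
  then have "((\<lambda>r. Re (star_height M L (of_real r * z))) has_real_derivative
     Re (2 * of_nat M * ?s ^ (2 * M - 1) * (1 + ?s * ?L') * (1 * z))) (at r)"
    by (rule has_real_derivative_Re_of_real)
  also have "2 * of_nat M * ?s ^ (2 * M - 1) * (1 + ?s * ?L') * (1 * z)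
     = (z ^ (2 * M - 1) * z) * (2 * of_nat M * of_real (r ^ (2 * M - 1)) * (1 + of_real r * (z * ?L')))"
    by (simp add: power_mult_distrib algebra_simps)
  also have "z ^ (2 * M - 1) * z = of_real \<sigma>"
    using power_minus_mult[of "2 * M" z] assms by simp
  also have "Re (of_real \<sigma> * (2 * of_nat M * of_real (r ^ (2 * M - 1)) * (1 + of_real r * (z * ?L'))))
     = \<sigma> * (2 * real M * r ^ (2 * M - 1) * (1 + r * Re (z * ?L')))"
    by (simp add: algebra_simps)
  finally show ?thesis by simp
qed

text \<open>With u = Re L on the ray, the first term of the defect is (r exp u)^(2M). Its derivative
  is that of the height multiplied by exp (2M u), because s^(2M) = r^(2M) on the ray; hence the
  common factor.\<close>

lemma defect_ray_deriv:
  fixes L :: "complex fps"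
  assumes "ereal \<bar>r\<bar> < fps_conv_radius L" "M \<ge> 1" "(z::complex) ^ (2 * M) = 1"
  shows "((\<lambda>r. defect M L (of_real r * z)) has_real_derivative
     2 * real M * r ^ (2 * M - 1) * (1 + r * Re (z * eval_fps (fps_deriv L) (of_real r * z))) *
     (exp (Re (eval_fps L (of_real r * z))) ^ (2 * M) - 1)) (at r)"
proof -
  have z: "norm z = 1"
    using assms(2,3) power_eq_1_iff[of z "2 * M"] by simp
  define u where "u r = Re (eval_fps L (of_real r * z))" for r
  define u' where "u' = Re (z * eval_fps (fps_deriv L) (of_real r * z))"
  have "((\<lambda>x. eval_fps L (x * z)) has_field_derivative
     eval_fps (fps_deriv L) (of_real r * z) * (1 * z)) (at (of_real r))"
    by (intro DERIV_chain2[where f = "eval_fps L"] eval_fps_deriv_at DERIV_cmult_right DERIV_ident)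
       (use assms z in \<open>auto simp: norm_mult\<close>)
  then have u: "(u has_real_derivative u') (at r)"
    unfolding u_def u'_def by (auto dest!: has_real_derivative_Re_of_real simp: mult.commute)
  have "((\<lambda>r. (r * exp (u r)) ^ (2 * M)) has_real_derivative
      of_nat (2 * M) * ((1 * exp (u r) + exp (u r) * u' * r) * (r * exp (u r)) ^ (2 * M - Suc 0))) (at r)"
    by (intro DERIV_power DERIV_mult DERIV_ident DERIV_chain2[OF DERIV_exp] u)
  from DERIV_diff[OF this star_height_ray_deriv[OF assms(1,2) z, of 1]] assms(3)
  have "((\<lambda>r. (r * exp (u r)) ^ (2 * M) - Re (star_height M L (of_real r * z))) has_real_derivative
      of_nat (2 * M) * ((1 * exp (u r) + exp (u r) * u' * r) * (r * exp (u r)) ^ (2 * M - Suc 0)) -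
       1 * (2 * real M * r ^ (2 * M - 1) * (1 + r * u'))) (at r)"
    by (simp add: u'_def)
  also have "of_nat (2 * M) * ((1 * exp (u r) + exp (u r) * u' * r) * (r * exp (u r)) ^ (2 * M - Suc 0)) -
       1 * (2 * real M * r ^ (2 * M - 1) * (1 + r * u'))
     = 2 * real M * r ^ (2 * M - 1) * (1 + r * u') * (exp (u r) ^ (2 * M - 1) * exp (u r) - 1)"
    by (simp add: power_mult_distrib algebra_simps)
  also have "exp (u r) ^ (2 * M - 1) * exp (u r) = exp (u r) ^ (2 * M)"
    using assms(2) by (intro power_minus_mult) simp
  also have "(\<lambda>r. (r * exp (u r)) ^ (2 * M) - Re (star_height M L (of_real r * z))) =
      (\<lambda>r. defect M L (of_real r * z))"
    by (simp add: defect_def star_radial_def u_def norm_mult z power_mult_distrib power_even_abs fun_eq_iff)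
  finally show ?thesis by (simp add: u_def u'_def)
qed

text \<open>Along a ray through a \<open>2M\<close>-th root of unity the derivative of the defect has the sign of
  \<open>exp (2 M Re L) - 1\<close>.\<close>

lemma sgn_defect_ray:
  assumes conv: "fps_conv_radius L > 0" and M: "M \<ge> 1"
  obtains \<delta> where "\<delta> > 0"
    "\<And>z r. z ^ (2 * M) = 1 \<Longrightarrow> 0 < r \<Longrightarrow> r < \<delta> \<Longrightarrow>
       \<exists>x. 0 < x \<and> x < r \<and>
         sgn (defect M L (of_real r * z)) = sgn (Re (eval_fps L (of_real x * z)))"
proof -
  obtain \<delta> where \<delta>: "\<delta> > 0" "\<And>s::complex. norm s < \<delta> \<Longrightarrow> ereal (norm s) < fps_conv_radius L"
    "\<And>s::complex. norm s < \<delta> \<Longrightarrow> norm (s * eval_fps (fps_deriv L) s) < 1"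
    by (rule small_log_derivative[OF conv]) (rule that)
  show ?thesis
  proof (rule that[OF \<delta>(1)])
    fix z :: complex and r :: real
    assume z: "z ^ (2 * M) = 1" and r: "0 < r" "r < \<delta>"
    have nz: "norm z = 1" using power_eq_1_iff[OF z] M by simp
    let ?d = "\<lambda>r::real. 2 * real M * r ^ (2 * M - 1) * (1 + r * Re (z * eval_fps (fps_deriv L) (of_real r * z))) *
     (exp (Re (eval_fps L (of_real r * z))) ^ (2 * M) - 1)"
    have "((\<lambda>r. defect M L (of_real r * z)) has_real_derivative ?d x) (at x)" if "0 \<le> x" "x \<le> r" for x
      using \<delta>(2)[of "of_real x"] that r by (intro defect_ray_deriv[OF _ M z]) auto
    \<comment> \<open>The defect vanishes at 0, so its sign at \<open>r\<close> is the sign of its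
      derivative at some intermediate \<open>x\<close>; the sign of Re L near 0 is all that is
      needed.\<close>
    from MVT2[OF r(1) this] obtain x where x: "0 < x" "x < r" and
      eq: "defect M L (of_real r * z) - defect M L (of_real 0 * z) = (r - 0) * ?d x" by blast
    have "\<bar>x * Re (z * eval_fps (fps_deriv L) (of_real x * z))\<bar>
        = \<bar>Re (of_real x * z * eval_fps (fps_deriv L) (of_real x * z))\<bar>"
      by (simp add: algebra_simps)
    also have "\<dots> \<le> norm (of_real x * z * eval_fps (fps_deriv L) (of_real x * z))"
      by (rule abs_Re_le_cmod)
    also have "\<dots> < 1"
      using \<delta>(3)[of "of_real x * z"] x r nz by (simp add: norm_mult)
    finally have pos: "1 + x * Re (z * eval_fps (fps_deriv L) (of_real x * z)) > 0" by linarith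
    let ?u = "Re (eval_fps L (of_real x * z))"
    have "sgn (exp ?u ^ (2 * M) - 1) = sgn ?u"
    proof -
      have "exp ?u ^ (2 * M) = exp (real (2 * M) * ?u)" by (simp only: exp_of_nat_mult)
      moreover have "real (2 * M) > 0" using M by simp
      ultimately show ?thesis
        by (cases ?u "0::real" rule: linorder_cases) (simp_all add: mult_pos_neg)
    qed
    moreover have "defect M L (of_real 0 * z) = 0" using M by (simp add: defect_def)
    ultimately have "sgn (defect M L (of_real r * z)) = sgn ?u"
      using eq pos x r M by (simp add: sgn_mult)
    with x show "\<exists>x. 0 < x \<and> x < r \<and>
         sgn (defect M L (of_real r * z)) = sgn (Re (eval_fps L (of_real x * z)))" by blast
  qed
qed

text \<open>On a ray where s^(2M) is negative the height has real part decreasing from 0. Such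
  critical points thus have positive defect.\<close>

lemma star_height_negative_rays:
  assumes conv: "fps_conv_radius L > 0" and M: "M \<ge> 1"
  shows "\<forall>\<^sub>F s in at 0. Im (s ^ (2 * M)) = 0 \<and> Re (s ^ (2 * M)) < 0 \<longrightarrow> Re (star_height M L s) < 0"
proof (rule small_log_derivative[OF conv])
  fix \<delta> :: real
  assume \<delta>: "\<delta> > 0" "\<And>s::complex. norm s < \<delta> \<Longrightarrow> ereal (norm s) < fps_conv_radius L"
    "\<And>s::complex. norm s < \<delta> \<Longrightarrow> norm (s * eval_fps (fps_deriv L) s) < 1"
  have "Re (star_height M L s) < 0"
    if s: "s \<noteq> 0" "norm s < \<delta>" "Im (s ^ (2 * M)) = 0" "Re (s ^ (2 * M)) < 0" for s
  proof -
    define r where "r = norm s"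
    define z where "z = s / of_real r"
    have r: "0 < r" "r < \<delta>" and nz: "norm z = 1" and sz: "s = of_real r * z"
      using s by (auto simp: r_def z_def norm_divide)
    define \<sigma> where "\<sigma> = Re (s ^ (2 * M)) / r ^ (2 * M)"
    have \<sigma>: "\<sigma> < 0" using s r by (simp add: \<sigma>_def divide_less_0_iff)
    have "s ^ (2 * M) = of_real (Re (s ^ (2 * M)))"
      using s(3) by (simp add: complex_eq_iff)
    then have z: "z ^ (2 * M) = of_real \<sigma>"
      by (simp add: z_def \<sigma>_def power_divide)
    let ?d = "\<lambda>r::real. \<sigma> * (2 * real M * r ^ (2 * M - 1) * (1 + r * Re (z * eval_fps (fps_deriv L) (of_real r * z))))"
    have "((\<lambda>r. Re (star_height M L (of_real r * z))) has_real_derivative ?d x) (at x)"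
      if "0 \<le> x" "x \<le> r" for x
      using \<delta>(2)[of "of_real x"] that r by (intro star_height_ray_deriv[OF _ M nz z]) auto
    from MVT2[OF r(1) this] obtain x where x: "0 < x" "x < r" and
      eq: "Re (star_height M L (of_real r * z)) - Re (star_height M L (of_real 0 * z)) = (r - 0) * ?d x" by blast
    have "\<bar>x * Re (z * eval_fps (fps_deriv L) (of_real x * z))\<bar>
        = \<bar>Re (of_real x * z * eval_fps (fps_deriv L) (of_real x * z))\<bar>"
      by (simp add: algebra_simps)
    also have "\<dots> \<le> norm (of_real x * z * eval_fps (fps_deriv L) (of_real x * z))"
      by (rule abs_Re_le_cmod)
    also have "\<dots> < 1"
      using \<delta>(3)[of "of_real x * z"] x r nz by (simp add: norm_mult)
    finally have "1 + x * Re (z * eval_fps (fps_deriv L) (of_real x * z)) > 0" by linarith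
    then have "(r - 0) * ?d x < 0"
      using x r M \<sigma> by (intro mult_pos_neg mult_neg_pos mult_pos_pos) auto
    with eq M show ?thesis by (simp add: sz)
  qed
  then show ?thesis
    unfolding eventually_at using \<delta>(1) by (auto simp: dist_norm)
qed

section \<open>Leading terms of the real part of a series along a ray\<close>

lemma Re_of_real_mult: "Re (of_real x * z) = x * Re z"
  by simp

lemma Re_eval_fps_ray_split:
  assumes "\<And>n. n < k \<Longrightarrow> Re (fps_nth L n * z ^ n) = 0"
    and "ereal (norm (of_real r * z)) < fps_conv_radius L"
  shows "Re (eval_fps L (of_real r * z)) =
     r ^ k * Re (z ^ k * eval_fps (fps_shift k L) (of_real r * z))"
proof -
  let ?s = "complex_of_real r * z"
  have sm: "summable (\<lambda>n. fps_nth L n * ?s ^ n)" using assms(2) by (rule summable_fps)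
  have sm': "summable (\<lambda>n. fps_nth (fps_shift k L) n * ?s ^ n)"
    using assms(2) by (intro summable_fps) simp
  have "eval_fps L ?s = (\<Sum>n. fps_nth L (n + k) * ?s ^ (n + k)) + (\<Sum>n<k. fps_nth L n * ?s ^ n)"
    unfolding eval_fps_def by (rule suminf_split_initial_segment[OF sm])
  also have "(\<Sum>n. fps_nth L (n + k) * ?s ^ (n + k)) = ?s ^ k * eval_fps (fps_shift k L) ?s"
    unfolding eval_fps_def suminf_mult[OF sm', symmetric]
    by (simp add: power_add algebra_simps)
  finally have "Re (eval_fps L ?s) = Re (?s ^ k * eval_fps (fps_shift k L) ?s) + (\<Sum>n<k. Re (fps_nth L n * ?s ^ n))"
    by simp
  also have "(\<Sum>n<k. Re (fps_nth L n * ?s ^ n)) = 0"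
  proof (intro sum.neutral ballI)
    fix n assume "n \<in> {..<k}"
    then have "Re (fps_nth L n * z ^ n) = 0" using assms(1) by simp
    moreover have "fps_nth L n * ?s ^ n = of_real (r ^ n) * (fps_nth L n * z ^ n)"
      by (simp add: power_mult_distrib)
    ultimately show "Re (fps_nth L n * ?s ^ n) = 0" by (metis mult_zero_right Re_of_real_mult)
  qed
  also have "?s ^ k * eval_fps (fps_shift k L) ?s = of_real (r ^ k) * (z ^ k * eval_fps (fps_shift k L) ?s)"
    by (simp add: power_mult_distrib)
  finally show ?thesis by (simp del: of_real_power)
qed

text \<open>Dividing out \<open>r ^ k\<close> leaves a function continuous at r = 0 with value
  \<open>Re (fps_nth L k * z ^ k)\<close>.\<close>

lemma Re_eval_fps_ray_sgn:
  assumes conv: "fps_conv_radius L > 0"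
    and zero: "\<And>n. n < k \<Longrightarrow> Re (fps_nth L n * z ^ n) = 0"
    and nz: "Re (fps_nth L k * z ^ k) \<noteq> 0"
  shows "\<forall>\<^sub>F r in at_right 0. sgn (Re (eval_fps L (of_real r * z))) = sgn (Re (fps_nth L k * z ^ k))"
proof -
  let ?b = "Re (fps_nth L k * z ^ k)"
  let ?h = "\<lambda>r. Re (z ^ k * eval_fps (fps_shift k L) (complex_of_real r * z))"
  have "isCont (eval_fps (fps_shift k L)) (complex_of_real 0 * z)"
    using conv by (intro continuous_intros) (auto simp: zero_ereal_def)
  then have "isCont (\<lambda>r. eval_fps (fps_shift k L) (complex_of_real r * z)) 0"
    by (rule isCont_o2[rotated]) (intro continuous_intros)
  then have "isCont ?h 0"
    by (intro isCont_Re isCont_mult continuous_intros)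
  then have lim: "(?h \<longlongrightarrow> ?b) (at_right 0)"
    using tendsto_mono[OF at_le[of "{0<..}" UNIV 0]]
    by (auto simp: isCont_def eval_fps_at_0 mult.commute)
  have "\<forall>\<^sub>F r in at_right 0. sgn (?h r) = sgn ?b"
  proof (cases "?b > 0")
    case True
    then show ?thesis using order_tendstoD(1)[OF lim, of 0] by (auto elim: eventually_mono)
  next
    case False
    then have "?b < 0" using nz by simp
    then show ?thesis using order_tendstoD(2)[OF lim, of 0] by (auto elim: eventually_mono)
  qed
  moreover have "\<forall>\<^sub>F r in at_right 0. ereal (norm (of_real r * z)) < fps_conv_radius L"
  proof -
    have "isCont (\<lambda>r. complex_of_real r * z) 0" by (intro continuous_intros)
    then have "((\<lambda>r. complex_of_real r * z) \<longlongrightarrow> 0) (at_right 0)"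
      using tendsto_mono[OF at_le[of "{0<..}" UNIV 0]] by (auto simp: isCont_def)
    from eventually_compose_filterlim[OF eventually_in_disc_of_convergence[OF conv] this]
    show ?thesis .
  qed
  moreover have "\<forall>\<^sub>F r in at_right 0. (0::real) < r"
    by (simp add: eventually_at_right_less)
  ultimately show ?thesis
  proof eventually_elim
    case (elim r)
    have "Re (eval_fps L (of_real r * z)) = r ^ k * ?h r"
      by (rule Re_eval_fps_ray_split[OF zero elim(2)])
    then have "sgn (Re (eval_fps L (of_real r * z))) = sgn (?h r)"
      using elim(3) by (simp only: sgn_mult) simp
    with elim(1) show ?case by (rule trans[rotated])
  qed
qed

lemma Re_eval_fps_ray_zero:
  assumes "\<And>n. Re (fps_nth L n * z ^ n) = 0"
    and "ereal (norm (of_real r * z)) < fps_conv_radius L"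
  shows "Re (eval_fps L (of_real r * z)) = 0"
proof -
  have "(\<lambda>n. fps_nth L n * (of_real r * z) ^ n) sums eval_fps L (of_real r * z)"
    using assms(2) by (rule sums_eval_fps)
  then have "(\<lambda>n. Re (fps_nth L n * (of_real r * z) ^ n)) sums Re (eval_fps L (of_real r * z))"
    by (rule sums_Re)
  moreover have "Re (fps_nth L n * (of_real r * z) ^ n) = 0" for n
  proof -
    have "fps_nth L n * (of_real r * z) ^ n = of_real (r ^ n) * (fps_nth L n * z ^ n)"
      by (simp add: power_mult_distrib)
    then show ?thesis using assms(1)[of n] by (metis mult_zero_right Re_of_real_mult)
  qed
  ultimately show ?thesis by (simp add: sums_iff)
qed

lemma eventually_at_of_nhds: "eventually P (nhds a) \<Longrightarrow> eventually P (at a within S)"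
  by (auto simp: eventually_at_filter elim: eventually_mono)

section \<open>From rays to a full neighborhood\<close>

text \<open>\<open>s0\<close> maximizes the real part of the height over the circle of all points
  with the same modulus of T as \<open>s\<close>, which is compact in the q-plane. The modulus term
  of the defect is constant there, so the defect can only drop. At a maximum s0^(2M) is real; the
  second alternative covers a negative value.\<close>

lemma defect_ge_defect_on_ray:
  assumes conv: "fps_conv_radius L > 0" and M: "M \<ge> 1" and "\<epsilon> > 0"
  shows "\<forall>\<^sub>F s in at 0. \<exists>s0. s0 \<noteq> 0 \<and> cmod s0 < \<epsilon> \<and> defect M L s0 \<le> defect M L s \<and>
     (s0 ^ (2 * M) = of_real (cmod s0 ^ (2 * M)) \<or> defect M L s0 > 0)"
proof -
  have "\<forall>\<^sub>F s0 in nhds 0. ((\<forall>\<^sub>F s in nhds s0. cmod (star_radial L s) = cmod (star_radial L s0) \<longrightarrow>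
        Re (star_height M L s) \<le> Re (star_height M L s0)) \<longrightarrow> Im (s0 ^ (2 * M)) = 0) \<and>
     (s0 \<noteq> 0 \<longrightarrow> Im (s0 ^ (2 * M)) = 0 \<and> Re (s0 ^ (2 * M)) < 0 \<longrightarrow> Re (star_height M L s0) < 0)"
    using local_max_on_circle_imp_real_power[OF conv M] star_height_negative_rays[OF conv M]
    unfolding eventually_at_filter by eventually_elim simp
  then obtain \<delta> where \<delta>: "\<delta> > 0" and crit: "\<And>s0. norm s0 < \<delta> \<Longrightarrow>
      (\<forall>\<^sub>F s in nhds s0. cmod (star_radial L s) = cmod (star_radial L s0) \<longrightarrow>
        Re (star_height M L s) \<le> Re (star_height M L s0)) \<Longrightarrow> Im (s0 ^ (2 * M)) = 0"
     and neg: "\<And>s0. norm s0 < \<delta> \<Longrightarrow> s0 \<noteq> 0 \<Longrightarrow> Im (s0 ^ (2 * M)) = 0 \<Longrightarrow> Re (s0 ^ (2 * M)) < 0 \<Longrightarrow>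
        Re (star_height M L s0) < 0"
    unfolding eventually_nhds_metric by (auto simp: dist_norm)
  \<comment> \<open>With this bound the local inverse takes values where the criticality criterion
    applies and also within \<open>\<epsilon>\<close>.\<close>
  have "min \<delta> \<epsilon> > 0" using \<delta> assms(3) by simp
  from conv this show ?thesis
  proof (rule star_radial_local_inverse, goal_cases)
    case (1 R \<rho> g)
    note inv = this
    have "\<forall>\<^sub>F s in nhds 0. star_radial L s \<in> ball 0 \<rho>"
      using DERIV_isCont[OF star_radial_deriv[OF inv(5)[of 0]]] inv(1,4)
      by (intro topological_tendstoD[of _ "0::complex"]) (auto simp: isCont_def tendsto_nhds_iff)
    moreover have "\<forall>\<^sub>F s in nhds (0::complex). s \<in> ball 0 R"
      using inv(1) by (intro eventually_nhds_in_open) auto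
    ultimately have "\<forall>\<^sub>F s in nhds (0::complex). star_radial L s \<in> ball 0 \<rho> \<and> s \<in> ball 0 R"
      by (rule eventually_conj)
    then show ?case
      unfolding eventually_at_filter
    proof eventually_elim
      case (elim s)
      show ?case
      proof (intro impI)
        assume s: "s \<noteq> 0"
        define q where "q = star_radial L s"
        have sub: "sphere 0 (norm q) \<subseteq> ball 0 \<rho>" using elim by (auto simp: q_def)
        have "isCont (\<lambda>x. Re (star_height M L (g x))) x" if x: "x \<in> ball 0 \<rho>" for x
        proof -
          have "isCont g x"
            using inv(6) x open_ball by (meson analytic_at_imp_isCont analytic_at)
          moreover have "isCont (star_height M L) (g x)"
            using DERIV_isCont[OF star_height_deriv[OF inv(5) M]] inv(7)[OF x] by blast
          ultimately show ?thesis by (intro isCont_Re) (rule isCont_o2)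
        qed
        then have "continuous_on (sphere 0 (norm q)) (\<lambda>x. Re (star_height M L (g x)))"
          using sub by (intro continuous_at_imp_continuous_on) auto
        moreover have "q \<in> sphere 0 (norm q)" by simp
        ultimately obtain q0 where q0: "q0 \<in> sphere 0 (norm q)"
          "\<And>x. x \<in> sphere 0 (norm q) \<Longrightarrow> Re (star_height M L (g x)) \<le> Re (star_height M L (g q0))"
          by (metis continuous_attains_sup[OF compact_sphere] empty_iff)
        define s0 where "s0 = g q0"
        have s0: "s0 \<in> ball 0 R" and Ts0: "star_radial L s0 = q0" 
          using inv(7)[OF subsetD[OF sub q0(1)]] by (auto simp: s0_def)
        have "q \<noteq> 0" using s by (simp add: q_def)
        then have "s0 \<noteq> 0" using Ts0 q0(1) by auto
        have small: "norm s0 < \<delta>" "norm s0 < \<epsilon>" using s0 inv(2) by auto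
        have "\<forall>\<^sub>F s in nhds s0. s \<in> ball 0 R" using s0 by (intro eventually_nhds_in_open) auto
        then have "\<forall>\<^sub>F s in nhds s0. cmod (star_radial L s) = cmod (star_radial L s0) \<longrightarrow>
          Re (star_height M L s) \<le> Re (star_height M L s0)"
        proof eventually_elim
          \<comment> \<open>Near \<open>s0\<close> each \<open>s'\<close> equals
            \<open>g (star_radial L s')\<close>, so a maximum over the whole circle in the q-plane
            is a local maximum in the s-plane.\<close>
          case (elim s')
          show ?case
            using q0(2)[of "star_radial L s'"] q0(1) inv(8)[OF elim] by (auto simp: Ts0 simp flip: s0_def)
        qed
        then have Im0: "Im (s0 ^ (2 * M)) = 0" by (rule crit[OF small(1)])
        have "s0 ^ (2 * M) = of_real (cmod s0 ^ (2 * M)) \<or> defect M L s0 > 0"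
        proof (cases "Re (s0 ^ (2 * M)) < 0")
          case True
          then have "Re (star_height M L s0) < 0" using neg small \<open>s0 \<noteq> 0\<close> Im0 by blast
          then show ?thesis by (simp add: defect_def add_nonneg_pos diff_less_0_iff_less 
                order.strict_trans2[of _ 0])
        next
          case False
          moreover have eq: "s0 ^ (2 * M) = of_real (Re (s0 ^ (2 * M)))" using Im0 by (simp add: complex_eq_iff)
          ultimately have "cmod (s0 ^ (2 * M)) = Re (s0 ^ (2 * M))"
            by (metis abs_of_nonneg norm_of_real not_less)
          with eq show ?thesis by (simp add: norm_power)
        qed
        moreover have "defect M L s0 \<le> defect M L s"
          using q0(1) q0(2)[of q] inv(8)[of s] elim Ts0 by (simp add: defect_def s0_def q_def)
        ultimately show "\<exists>s0. s0 \<noteq> 0 \<and> cmod s0 < \<epsilon> \<and> defect M L s0 \<le> defect M L s \<and>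
           (s0 ^ (2 * M) = of_real (cmod s0 ^ (2 * M)) \<or> defect M L s0 > 0)"
          using \<open>s0 \<noteq> 0\<close> small by blast
      qed
    qed
  qed
qed

lemma positive_power_imp_root_of_unity:
  assumes "s \<noteq> 0" "s ^ n = of_real (cmod s ^ n)"
  shows "(s / of_real (cmod s)) ^ n = 1"
  using assms by (simp add: power_divide)

lemma defect_nonneg_of_rays:
  assumes conv: "fps_conv_radius L > 0" and M: "M \<ge> 1" and "\<delta> > 0"
    and rays: "\<And>z r. z ^ (2 * M) = 1 \<Longrightarrow> 0 < r \<Longrightarrow> r < \<delta> \<Longrightarrow> defect M L (of_real r * z) \<ge> 0"
  shows "\<forall>\<^sub>F s in nhds 0. defect M L s \<ge> 0"
proof -
  have "\<forall>\<^sub>F s in at 0. defect M L s \<ge> 0"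
    using defect_ge_defect_on_ray[OF conv M assms(3)]
  proof eventually_elim
    case (elim s)
    then obtain s0 where s0: "s0 \<noteq> 0" "cmod s0 < \<delta>" "defect M L s0 \<le> defect M L s"
      "s0 ^ (2 * M) = of_real (cmod s0 ^ (2 * M)) \<or> defect M L s0 > 0" by blast
    have "defect M L s0 \<ge> 0"
      using s0(4) rays[OF positive_power_imp_root_of_unity[OF s0(1)], of "cmod s0"] s0(1,2) by auto
    with s0(3) show ?case by simp
  qed
  moreover have "defect M L 0 \<ge> 0" using M by (simp add: defect_def)
  ultimately show ?thesis
    unfolding eventually_at_filter by (auto elim: eventually_mono)
qed

lemma defect_pos_of_rays:
  assumes conv: "fps_conv_radius L > 0" and M: "M \<ge> 1" and "\<delta> > 0"
    and rays: "\<And>z r. z ^ (2 * M) = 1 \<Longrightarrow> 0 < r \<Longrightarrow> r < \<delta> \<Longrightarrow> defect M L (of_real r * z) > 0"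
  shows "\<forall>\<^sub>F s in at 0. defect M L s > 0"
  using defect_ge_defect_on_ray[OF conv M assms(3)]
proof eventually_elim
  case (elim s)
  then obtain s0 where s0: "s0 \<noteq> 0" "cmod s0 < \<delta>" "defect M L s0 \<le> defect M L s"
    "s0 ^ (2 * M) = of_real (cmod s0 ^ (2 * M)) \<or> defect M L s0 > 0" by blast
  have "defect M L s0 > 0"
    using s0(4) rays[OF positive_power_imp_root_of_unity[OF s0(1)], of "cmod s0"] s0(1,2) by auto
  with s0(3) show ?case by simp
qed

text \<open>Where the defect is nonnegative, a zero is a local minimum of it, hence a local maximum
  of the height on its own circle. The zero itself is thus a critical point, and a negative s^(2M)
  is impossible because the height there has real part at least 0.\<close>

lemma defect_zero_imp_on_ray:
  assumes conv: "fps_conv_radius L > 0" and M: "M \<ge> 1"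
    and nonneg: "\<forall>\<^sub>F s in nhds 0. defect M L s \<ge> 0"
  shows "\<forall>\<^sub>F s in at 0. defect M L s = 0 \<longrightarrow> s ^ (2 * M) = of_real (cmod s ^ (2 * M))"
proof -
  have "\<forall>\<^sub>F s0 in nhds 0. \<forall>\<^sub>F s in nhds s0. defect M L s \<ge> 0"
    using nonneg by (simp add: eventually_eventually)
  then have "\<forall>\<^sub>F s0 in at 0. \<forall>\<^sub>F s in nhds s0. defect M L s \<ge> 0"
    by (rule eventually_at_of_nhds)
  moreover have "\<forall>\<^sub>F s0 in at 0. (\<forall>\<^sub>F s in nhds s0. cmod (star_radial L s) = cmod (star_radial L s0) \<longrightarrow>
        Re (star_height M L s) \<le> Re (star_height M L s0)) \<longrightarrow> Im (s0 ^ (2 * M)) = 0"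
    using local_max_on_circle_imp_real_power[OF conv M] by (rule eventually_at_of_nhds)
  ultimately show ?thesis
    using star_height_negative_rays[OF conv M]
  proof eventually_elim
    case (elim s0)
    show ?case
    proof
      assume D: "defect M L s0 = 0"
      have "\<forall>\<^sub>F s in nhds s0. cmod (star_radial L s) = cmod (star_radial L s0) \<longrightarrow>
        Re (star_height M L s) \<le> Re (star_height M L s0)"
        using elim(1) by eventually_elim (use D in \<open>auto simp: defect_def\<close>)
      then have Im0: "Im (s0 ^ (2 * M)) = 0" using elim(2) by blast
      have "Re (star_height M L s0) = cmod (star_radial L s0) ^ (2 * M)"
        using D by (simp add: defect_def)
      then have "Re (star_height M L s0) \<ge> 0" by simp
      then have nn: "Re (s0 ^ (2 * M)) \<ge> 0" using elim(3) Im0 by force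
      have eq: "s0 ^ (2 * M) = of_real (Re (s0 ^ (2 * M)))" using Im0 by (simp add: complex_eq_iff)
      then have "cmod (s0 ^ (2 * M)) = Re (s0 ^ (2 * M))"
        using nn by (metis abs_of_nonneg norm_of_real)
      with eq show "s0 ^ (2 * M) = of_real (cmod s0 ^ (2 * M))" by (simp add: norm_power)
    qed
  qed
qed

section \<open>The coefficient that decides the sign on a ray\<close>

lemma sgn_defect_on_ray_first_coeff:
  assumes conv: "fps_conv_radius L > 0" and M: "M \<ge> 1" and z: "z ^ (2 * M) = 1"
    and zero: "\<And>n. n < k \<Longrightarrow> Re (fps_nth L n * z ^ n) = 0"
    and nz: "Re (fps_nth L k * z ^ k) \<noteq> 0"
  shows "\<forall>\<^sub>F r in at_right 0. sgn (defect M L (of_real r * z)) = sgn (Re (fps_nth L k * z ^ k))"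
proof (rule sgn_defect_ray[OF conv M])
  fix \<delta> :: real
  assume \<delta>: "\<delta> > 0" "\<And>z r. z ^ (2 * M) = 1 \<Longrightarrow> 0 < r \<Longrightarrow> r < \<delta> \<Longrightarrow>
       \<exists>x. 0 < x \<and> x < r \<and>
         sgn (defect M L (of_real r * z)) = sgn (Re (eval_fps L (of_real x * z)))"
  obtain \<epsilon> where \<epsilon>: "\<epsilon> > 0" "\<And>x. 0 < x \<Longrightarrow> x < \<epsilon> \<Longrightarrow>
      sgn (Re (eval_fps L (of_real x * z))) = sgn (Re (fps_nth L k * z ^ k))"
    using Re_eval_fps_ray_sgn[OF conv zero nz] unfolding eventually_at_right_field by auto
  have "sgn (defect M L (of_real r * z)) = sgn (Re (fps_nth L k * z ^ k))"
    if r: "0 < r" "r < min \<delta> \<epsilon>" for r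
    using \<delta>(2)[OF z, of r] \<epsilon>(2) r by force
  then show ?thesis
    unfolding eventually_at_right_field using \<delta>(1) \<epsilon>(1) by (intro exI[of _ "min \<delta> \<epsilon>"]) auto
qed

lemma defect_on_ray_zero:
  assumes conv: "fps_conv_radius L > 0" and M: "M \<ge> 1"
    and zero: "\<And>z n. z ^ (2 * M) = 1 \<Longrightarrow> Re (fps_nth L n * z ^ n) = 0"
  obtains \<delta> where "\<delta> > 0" "\<And>z r. z ^ (2 * M) = 1 \<Longrightarrow> 0 < r \<Longrightarrow> r < \<delta> \<Longrightarrow> defect M L (of_real r * z) = 0"
proof (rule sgn_defect_ray[OF conv M], rule convergent_radius_obtain[OF conv])
  fix \<delta> R :: real
  assume \<delta>: "\<delta> > 0" "\<And>z r. z ^ (2 * M) = 1 \<Longrightarrow> 0 < r \<Longrightarrow> r < \<delta> \<Longrightarrow>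
       \<exists>x. 0 < x \<and> x < r \<and>
         sgn (defect M L (of_real r * z)) = sgn (Re (eval_fps L (of_real x * z)))"
  assume R: "R > 0" "\<And>s::complex. norm s < R \<Longrightarrow> ereal (norm s) < fps_conv_radius L"
  show ?thesis
  proof (rule that[of "min \<delta> R"])
    fix z :: complex and r :: real
    assume z: "z ^ (2 * M) = 1" and r: "0 < r" "r < min \<delta> R"
    obtain x where x: "0 < x" "x < r" and
      eq: "sgn (defect M L (of_real r * z)) = sgn (Re (eval_fps L (of_real x * z)))"
      using \<delta>(2)[OF z, of r] r by auto
    have "norm z = 1" using power_eq_1_iff[OF z] M by simp
    then have "ereal (norm (of_real x * z)) < fps_conv_radius L"
      using x r by (intro R(2)) (simp add: norm_mult)
    with eq Re_eval_fps_ray_zero[OF zero[OF z]] show "defect M L (of_real r * z) = 0"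
      by (simp add: sgn_0_0)
  qed (use \<delta> R in simp)
qed

section \<open>Roots of unity\<close>

text \<open>For \<open>M \<ge> 1\<close> a primitive 2M-th root of unity. Its powers separate two
  divisibility conditions: they are real only at multiples of M and equal to 1 only at multiples of
  2M.\<close>

definition half_unit_root :: "nat \<Rightarrow> complex" where
  "half_unit_root M = cis (pi / M)"

lemma half_unit_root_power: "half_unit_root M ^ k = cis (pi * k / M)"
  by (simp add: half_unit_root_def Complex.DeMoivre mult.commute)

lemma half_unit_root_power_double: "M \<ge> 1 \<Longrightarrow> half_unit_root M ^ (2 * M) = 1"
  by (simp add: half_unit_root_power complex_eq_iff mult.commute[of pi])

lemma Im_half_unit_root_power_eq_0:
  assumes "M \<ge> 1" "Im (half_unit_root M ^ k) = 0"
  shows "M dvd k"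
proof -
  have "sin (pi * k / M) = 0" using assms by (simp add: half_unit_root_power)
  then obtain i :: int where "pi * k / M = of_int i * pi"
    by (auto simp: sin_zero_iff_int2)
  then have "real k = of_int i * real M" using assms(1) by (simp add: field_simps)
  then have "of_int (int k) = (of_int (i * int M) :: real)" by simp
  then have "int k = i * int M" by (simp only: of_int_eq_iff)
  then show ?thesis by (metis dvd_triv_right int_dvd_int_iff)
qed

lemma half_unit_root_power_eq_1:
  assumes "M \<ge> 1" "half_unit_root M ^ k = 1"
  shows "2 * M dvd k"
proof -
  have "M dvd k" using assms by (intro Im_half_unit_root_power_eq_0) auto
  then obtain j where j: "k = M * j" by blast
  have "cos (pi * real j) = 1"
    using assms j by (simp add: half_unit_root_power complex_eq_iff)
  then have "even j" using cos_npi2[of j] by (cases "even j") auto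
  with j show ?thesis by auto
qed

text \<open>The average of \<open>z\<^bsup>k\<^esup>\<close> over the \<open>2M\<close>-th roots of unity vanishes unless \<open>2M\<close> divides \<open>k\<close>.\<close>

lemma nonneg_on_roots_imp_zero:
  assumes M: "M \<ge> 1" and k: "\<not> 2 * M dvd k"
    and nn: "\<And>z. z ^ (2 * M) = 1 \<Longrightarrow> Re (a * z ^ k) \<ge> 0"
    and z: "z ^ (2 * M) = 1"
  shows "Re (a * z ^ k) = 0"
proof -
  define w where "w = half_unit_root M"
  have w: "w ^ (2 * M) = 1" unfolding w_def by (rule half_unit_root_power_double[OF M])
  have wk: "w ^ k \<noteq> 1" using half_unit_root_power_eq_1[OF M] k by (auto simp: w_def)
  have "(w ^ k) ^ (2 * M) = 1" using w by (metis power_commutes power_mult power_one mult.commute)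
  then have gs: "(\<Sum>j<2 * M. (w ^ k) ^ j) = 0" using wk by (simp add: sum_gp_strict)
  have "(\<Sum>j<2 * M. a * (z * w ^ j) ^ k) = (\<Sum>j<2 * M. a * z ^ k * (w ^ k) ^ j)"
    by (intro sum.cong refl) (simp add: power_mult_distrib mult.commute flip: power_mult)
  also have "\<dots> = 0" using gs by (simp flip: sum_distrib_left)
  finally have "(\<Sum>j<2 * M. Re (a * (z * w ^ j) ^ k)) = 0"
    by (metis Re_sum zero_complex.sel(1))
  moreover have "Re (a * (z * w ^ j) ^ k) \<ge> 0" for j
  proof (rule nn)
    have "(w ^ j) ^ (2 * M) = 1" using w by (metis power_mult power_one mult.commute)
    then show "(z * w ^ j) ^ (2 * M) = 1" using z by (simp add: power_mult_distrib)
  qed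
  ultimately have "\<forall>j\<in>{..<2*M}. Re (a * (z * w ^ j) ^ k) = 0"
    by (subst (asm) sum_nonneg_eq_0_iff) auto
  \<comment> \<open>The sum runs over the roots \<open>z * w ^ j\<close>, so its term j = 0 is the
    value at \<open>z\<close> itself.\<close>
  from bspec[OF this, of 0] M show ?thesis by simp
qed

text \<open>The root 1 removes the real part of \<open>a\<close>; at \<open>half_unit_root M\<close>
  the condition becomes Im a times Im of a power that is not real unless M divides n.\<close>

lemma coeff_of_zero_on_roots:
  assumes M: "M \<ge> 1" and zero: "\<And>z. z ^ (2 * M) = 1 \<Longrightarrow> Re (a * z ^ n) = 0"
  shows "Re a = 0" "\<not> M dvd n \<Longrightarrow> a = 0"
proof -
  show *: "Re a = 0" using zero[of 1] by simp
  assume "\<not> M dvd n"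
  then have "Im (half_unit_root M ^ n) \<noteq> 0" using Im_half_unit_root_power_eq_0[OF M] by blast
  moreover have "Re (a * half_unit_root M ^ n) = 0"
    by (intro zero half_unit_root_power_double M)
  ultimately show "a = 0" using * by (simp add: complex_eq_iff)
qed

lemma root_power_multiple_real:
  assumes "(z::complex) ^ (2 * M) = 1"
  shows "z ^ (M * j) = 1 \<or> z ^ (M * j) = -1"
proof -
  have "(z ^ (M * j))\<^sup>2 = 1"
    using assms by (metis mult.assoc mult.commute power_mult power_one)
  then show ?thesis by (simp add: power2_eq_1_iff)
qed

section \<open>Coefficients and the two types\<close>

text \<open>The index bound \<open>n < 2 * M * K\<close> becomes \<open>j < 2 * K\<close> for n = M
  j, which is the degree bound on the polynomial; all coefficients from \<open>2 * M * K\<close> on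
  go into the tail \<open>L1\<close>.\<close>

lemma isolated_type_of_coeffs:
  assumes M: "M \<ge> 1" and conv: "L \<in> convergent_series" and K: "K \<ge> 1"
    and low: "\<And>n. n < 2 * M * K \<Longrightarrow> Re (fps_nth L n) = 0 \<and> (\<not> M dvd n \<longrightarrow> fps_nth L n = 0)"
    and pos: "Re (fps_nth L (2 * M * K)) > 0"
  shows "isolated_type M L"
proof -
  define A where "A = (\<Sum>j<2 * K. monom (Im (fps_nth L (M * j))) j)"
  define L1 where "L1 = fps_shift (2 * M * K) L"
  have cA: "coeff A j = (if j < 2 * K then Im (fps_nth L (M * j)) else 0)" for j
    by (simp add: A_def coeff_sum)
  \<comment> \<open>The non-strict bound is \<open>2 * K - 1\<close>, a truncated subtraction;
    \<open>K \<ge> 1\<close> makes it smaller than \<open>2 * K\<close>.\<close>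
  have deg: "degree A < 2 * K"
    using K by (intro order.strict_trans1[OF degree_le[of "2 * K - 1"]]) (auto simp: cA)
  have "L = fps_const \<i> * (fps_of_poly (map_poly complex_of_real A) oo fps_X ^ M)
            + fps_X ^ (2 * M * K) * L1"
  proof (rule fps_ext)
    fix n
    have "fps_nth L n = (if M dvd n then \<i> * of_real (coeff A (n div M)) else 0)" if n: "n < 2 * M * K"
    proof (cases "M dvd n")
      case True
      then obtain j where j: "n = M * j" by blast
      then have "j < 2 * K" using n by (simp add: mult.assoc mult.left_commute)
      then show ?thesis using low[OF n] M by (simp add: j cA complex_eq_iff)
    qed (use low[OF n] in simp)
    moreover have "coeff A (n div M) = 0" if n: "\<not> n < 2 * M * K"
    proof -
      have "2 * K \<le> n div M" using n M by (simp add: less_eq_div_iff_mult_less_eq mult_ac)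
      then show ?thesis by (simp add: cA)
    qed
    ultimately show "fps_nth L n = fps_nth (fps_const \<i> * (fps_of_poly (map_poly complex_of_real A) oo fps_X ^ M)
            + fps_X ^ (2 * M * K) * L1) n"
      using M by (auto simp: fps_nth_compose_X_power coeff_map_poly fps_X_power_mult_nth L1_def)
  qed
  moreover have "L1 \<in> convergent_series" "Re (fps_nth L1 0) > 0"
    using conv pos by (auto simp: L1_def convergent_series_def)
  ultimately show ?thesis
    unfolding isolated_type_def using M K deg by blast
qed

lemma isolated_type_coeffs:
  assumes "isolated_type M L"
  obtains K where "K \<ge> 1" "Re (fps_nth L (2 * M * K)) > 0"
    "\<And>n. n < 2 * M * K \<Longrightarrow> Re (fps_nth L n) = 0 \<and> (\<not> M dvd n \<longrightarrow> fps_nth L n = 0)"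
proof -
  from assms obtain K :: nat and A L1 where M: "M \<ge> 1" and K: "K \<ge> 1" "degree A < 2 * K" "Re (fps_nth L1 0) > 0"
    and L: "L = fps_const \<i> * (fps_of_poly (map_poly complex_of_real A) oo fps_X ^ M)
            + fps_X ^ (2 * M * K) * L1"
    unfolding isolated_type_def by blast
  have nth: "fps_nth L n = (if M dvd n then \<i> * of_real (coeff A (n div M)) else 0) +
     (if n < 2 * M * K then 0 else fps_nth L1 (n - 2 * M * K))" for n
    using M by (simp add: L fps_nth_compose_X_power coeff_map_poly fps_X_power_mult_nth)
  show ?thesis
  proof (rule that[OF K(1)])
    show "Re (fps_nth L (2 * M * K)) > 0" using K by (simp add: nth)
  qed (simp add: nth)
qed

lemma nonneg_defect_coeffs:
  assumes conv: "L \<in> convergent_series" and M: "M \<ge> 1" and L0: "fps_nth L 0 = 0"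
    and nonneg: "\<forall>\<^sub>F s in nhds 0. defect M L s \<ge> 0"
  shows "(\<forall>n. Re (fps_nth L n) = 0 \<and> (\<not> M dvd n \<longrightarrow> fps_nth L n = 0)) \<or> isolated_type M L"
proof (cases "\<exists>k z. z ^ (2 * M) = 1 \<and> Re (fps_nth L k * z ^ k) \<noteq> 0")
  case False
  then show ?thesis using coeff_of_zero_on_roots[OF M] by blast
next
  case True
  \<comment> \<open>Least over all rays at once: below \<open>k\<close> the real parts vanish on
    every ray, so the sign criterion applies with the same index wherever the value at
    \<open>k\<close> is nonzero.\<close>
  define k where "k = (LEAST k. \<exists>z. z ^ (2 * M) = 1 \<and> Re (fps_nth L k * z ^ k) \<noteq> 0)"
  obtain z where z: "z ^ (2 * M) = 1" "Re (fps_nth L k * z ^ k) \<noteq> 0"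
    using LeastI_ex[OF True] unfolding k_def by blast
  have low: "Re (fps_nth L n * z ^ n) = 0" if "n < k" "z ^ (2 * M) = 1" for n z
    using not_less_Least[of n "\<lambda>k. \<exists>z. z ^ (2 * M) = 1 \<and> Re (fps_nth L k * z ^ k) \<noteq> 0"] that
    unfolding k_def by blast
  have conv': "fps_conv_radius L > 0" using conv by (simp add: convergent_series_def)
  have ge: "Re (fps_nth L k * z ^ k) \<ge> 0" if z: "z ^ (2 * M) = 1" for z
  proof (rule ccontr)
    assume neg: "\<not> ?thesis"
    have "\<forall>\<^sub>F r in at_right 0. sgn (defect M L (of_real r * z)) = sgn (Re (fps_nth L k * z ^ k))"
      by (rule sgn_defect_on_ray_first_coeff[OF conv' M z low]) (use neg z in auto)
    moreover have "\<forall>\<^sub>F r in at_right 0. defect M L (of_real r * z) \<ge> 0"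
    proof (rule eventually_compose_filterlim[OF nonneg])
      have "isCont (\<lambda>r. complex_of_real r * z) 0" by (intro continuous_intros)
      then show "((\<lambda>r. complex_of_real r * z) \<longlongrightarrow> 0) (at_right 0)"
        using tendsto_mono[OF at_le[of "{0<..}" UNIV 0]] by (auto simp: isCont_def)
    qed
    ultimately have "\<forall>\<^sub>F r::real in at_right 0. False"
      by eventually_elim (use neg in \<open>auto simp: sgn_if split: if_splits\<close>)
    then show False by simp
  qed
  have "2 * M dvd k" using nonneg_on_roots_imp_zero[OF M _ ge z(1)] z(2) by blast
  then obtain K where K: "k = 2 * M * K" by blast
  \<comment> \<open>\<open>K = 0\<close> would mean k = 0, where the coefficient is zero by
    \<open>L0\<close>.\<close>
  have K1: "K \<ge> 1" using z L0 K by (cases K) auto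
  have zk: "z ^ k = 1" using z(1) by (simp add: K power_mult)
  show ?thesis
  proof (intro disjI2 isolated_type_of_coeffs[OF M conv K1])
    show "Re (fps_nth L (2 * M * K)) > 0" using z(2) ge[OF z(1)] zk by (simp add: K)
    show "Re (fps_nth L n) = 0 \<and> (\<not> M dvd n \<longrightarrow> fps_nth L n = 0)" if "n < 2 * M * K" for n
      using coeff_of_zero_on_roots[OF M, of "fps_nth L n" n] low[of n] that by (auto simp: K)
  qed
qed

text \<open>Nonzero coefficients below \<open>2 * M * K\<close> are imaginary and sit at indices M
  j, where every root has power 1 or -1, so they drop out on each ray. At \<open>2 * M * K\<close>
  the power is 1, and the same positive number decides on all rays.\<close>

lemma isolated_type_defect_pos:
  assumes conv: "L \<in> convergent_series" and iso: "isolated_type M L"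
  shows "\<forall>\<^sub>F s in at 0. defect M L s > 0"
proof -
  have conv': "fps_conv_radius L > 0" using conv by (simp add: convergent_series_def)
  have M: "M \<ge> 1" using iso by (simp add: isolated_type_def)
  from iso obtain K where K: "K \<ge> 1" "Re (fps_nth L (2 * M * K)) > 0"
    "\<And>n. n < 2 * M * K \<Longrightarrow> Re (fps_nth L n) = 0 \<and> (\<not> M dvd n \<longrightarrow> fps_nth L n = 0)"
    by (rule isolated_type_coeffs) (rule that)
  have ray: "\<forall>\<^sub>F r in at_right 0. defect M L (of_real r * z) > 0" if z: "z ^ (2 * M) = 1" for z
  proof -
    have zk: "z ^ (2 * M * K) = 1" using z by (simp add: power_mult)
    have "\<forall>\<^sub>F r in at_right 0. sgn (defect M L (of_real r * z)) = sgn (Re (fps_nth L (2 * M * K) * z ^ (2 * M * K)))"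
    proof (rule sgn_defect_on_ray_first_coeff[OF conv' M z])
      fix n assume n: "n < 2 * M * K"
      show "Re (fps_nth L n * z ^ n) = 0"
      proof (cases "M dvd n")
        case True
        then obtain j where j: "n = M * j" by blast
        with K(3)[OF n] root_power_multiple_real[OF z, of j] show ?thesis by auto
      qed (use K(3)[OF n] in simp)
    qed (use K zk in auto)
    then show ?thesis
      by eventually_elim (use K zk in \<open>auto simp: sgn_if split: if_splits\<close>)
  qed
  \<comment> \<open>Finitely many rays, so one radius serves them all.\<close>
  have "finite {z::complex. z ^ (2 * M) = 1}" using M by (intro finite_roots_unity) simp
  then have "\<forall>\<^sub>F r in at_right 0. \<forall>z\<in>{z. z ^ (2 * M) = 1}. defect M L (of_real r * z) > 0"
    using ray by (intro eventually_ball_finite) auto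
  then obtain \<delta> where "\<delta> > 0" "\<And>z r. z ^ (2 * M) = 1 \<Longrightarrow> 0 < r \<Longrightarrow> r < \<delta> \<Longrightarrow> defect M L (of_real r * z) > 0"
    unfolding eventually_at_right_field by auto
  then show ?thesis by (rule defect_pos_of_rays[OF conv' M])
qed

lemma curve_type_rays:
  assumes "curve_type M L" "z ^ (2 * M) = 1"
  shows "Re (fps_nth L n * z ^ n) = 0"
proof -
  have "z = 1 \<or> z = -1" using assms by (simp add: curve_type_def power2_eq_1_iff)
  then have "z ^ n = 1 \<or> z ^ n = -1" by (cases "even n") auto
  then show ?thesis using assms(1) by (auto simp: curve_type_def imaginary_series_def)
qed

text \<open>For M = 1 the two rays form the real axis, and an imaginary series makes the defect
  vanish along them. Nonnegativity elsewhere comes from the reduction to rays, and it in turn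
  confines the zeros to the rays.\<close>

lemma curve_type_defect:
  assumes conv: "L \<in> convergent_series" and ct: "curve_type M L"
  shows "\<forall>\<^sub>F s in nhds 0. defect M L s \<ge> 0"
    and "\<forall>\<^sub>F s in nhds 0. defect M L s = 0 \<longleftrightarrow> Im s = 0"
proof -
  have conv': "fps_conv_radius L > 0" using conv by (simp add: convergent_series_def)
  have M1: "M = 1" using ct by (simp add: curve_type_def)
  then have M: "M \<ge> 1" by simp
  obtain \<delta> where \<delta>: "\<delta> > 0" "\<And>z r. z ^ (2 * M) = 1 \<Longrightarrow> 0 < r \<Longrightarrow> r < \<delta> \<Longrightarrow> defect M L (of_real r * z) = 0"
    using defect_on_ray_zero[OF conv' M curve_type_rays[OF ct]] by blast
  show nn: "\<forall>\<^sub>F s in nhds 0. defect M L s \<ge> 0"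
    by (rule defect_nonneg_of_rays[OF conv' M \<delta>(1)]) (simp add: \<delta>(2))
  have real: "defect M L s = 0" if s: "norm s < \<delta>" "Im s = 0" for s
  proof (cases "s = 0")
    case False
    have eq: "s = of_real (Re s)" using s by (simp add: complex_eq_iff)
    then have "cmod s = \<bar>Re s\<bar>" by (metis norm_of_real)
    then have "s ^ (2 * M) = of_real (cmod s ^ (2 * M))"
      using M1 eq by (metis power_even_abs even_mult_iff even_numeral of_real_power)
    from \<delta>(2)[OF positive_power_imp_root_of_unity[OF False this], of "cmod s"] False s show ?thesis
      by simp
  qed (use M in \<open>simp add: defect_def\<close>)
  have "\<forall>\<^sub>F s in nhds 0. s \<noteq> 0 \<longrightarrow> defect M L s = 0 \<longrightarrow> s ^ (2 * M) = of_real (cmod s ^ (2 * M))"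
    using defect_zero_imp_on_ray[OF conv' M nn] by (simp add: eventually_at_filter)
  moreover have "\<forall>\<^sub>F s in nhds (0::complex). s \<in> ball 0 \<delta>" using \<delta>(1) by (intro eventually_nhds_in_open) auto
  ultimately show "\<forall>\<^sub>F s in nhds 0. defect M L s = 0 \<longleftrightarrow> Im s = 0"
  proof eventually_elim
    case (elim s)
    have "Im s = 0" if "s\<^sup>2 = of_real ((cmod s)\<^sup>2)"
    proof -
      have "(Re s)\<^sup>2 - (Im s)\<^sup>2 = (Re s)\<^sup>2 + (Im s)\<^sup>2"
        using arg_cong[OF that, of Re] by (simp add: power2_eq_square cmod_power2 del: of_real_power)
          (simp add: cmod_power2 flip: power2_eq_square)
      then show ?thesis by simp
    qed
    then show ?case using elim real[of s] M1 by (cases "s = 0") auto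
  qed
qed

section \<open>Rotational symmetry of series in a power of the variable\<close>

lemma eval_fps_rotate:
  fixes L :: "complex fps"
  assumes "\<And>n. \<not> M dvd n \<Longrightarrow> fps_nth L n = 0" "w ^ M = 1"
  shows "eval_fps L (w * s) = eval_fps L s"
proof -
  have "fps_nth L n * (w * s) ^ n = fps_nth L n * s ^ n" for n
    using assms by (cases "M dvd n") (auto simp: power_mult_distrib power_mult)
  then show ?thesis by (simp only: eval_fps_def)
qed

lemma star_radial_rotate:
  assumes "\<And>n. \<not> M dvd n \<Longrightarrow> fps_nth L n = 0" "w ^ M = 1"
  shows "star_radial L (w * s) = w * star_radial L s"
  by (simp add: star_radial_def eval_fps_rotate[OF assms])

text \<open>Both sides agree at 0 and have the same derivative: \<open>w L'(w x) = L'(x)\<close>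
  follows by differentiating the invariance of \<open>L\<close>, and w^(2M) = 1.\<close>

lemma star_height_rotate:
  assumes L: "\<And>n. \<not> M dvd n \<Longrightarrow> fps_nth L n = 0" and w: "w ^ M = 1" and M: "M \<ge> 1"
    and s: "ereal (norm s) < fps_conv_radius L"
  shows "star_height M L (w * s) = star_height M L s"
proof -
  obtain R where R: "norm s < R" "ereal R < fps_conv_radius L"
    using ereal_dense2[OF s] by auto
  let ?B = "ball 0 R :: complex set"
  have conv: "ereal (norm x) < fps_conv_radius L" if "x \<in> ?B" for x
    using that R(2) by (simp add: less_trans[of "ereal (norm x)" "ereal R"])
  have nw: "norm w = 1" using power_eq_1_iff[OF w] M by simp
  have L': "eval_fps (fps_deriv L) (w * x) * w = eval_fps (fps_deriv L) x" if "x \<in> ?B" for x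
  proof (rule DERIV_unique)
    have "((\<lambda>x. eval_fps L (w * x)) has_field_derivative eval_fps (fps_deriv L) (w * x) * (w * 1)) (at x)"
      by (intro DERIV_chain2[where f = "eval_fps L"] eval_fps_deriv_at DERIV_cmult DERIV_ident)
         (use conv[OF that] nw in \<open>simp add: norm_mult\<close>)
    then show "(eval_fps L has_field_derivative eval_fps (fps_deriv L) (w * x) * w) (at x)"
      by (simp add: eval_fps_rotate[OF L w])
    show "(eval_fps L has_field_derivative eval_fps (fps_deriv L) x) (at x)"
      by (intro eval_fps_deriv_at conv that)
  qed
  have "\<exists>k. \<forall>x\<in>?B. star_height M L (w * x) - star_height M L x = k"
  proof (rule has_field_derivative_zero_constant)
    show "convex ?B" by simp
    fix x assume x: "x \<in> ?B"
    have "((\<lambda>x. star_height M L (w * x) - star_height M L x) has_field_derivative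
       2 * of_nat M * (w * x) ^ (2 * M - 1) * (1 + (w * x) * eval_fps (fps_deriv L) (w * x)) * (w * 1) -
       2 * of_nat M * x ^ (2 * M - 1) * (1 + x * eval_fps (fps_deriv L) x)) (at x)"
      by (intro DERIV_diff DERIV_chain2[where f = "star_height M L"] star_height_deriv DERIV_cmult DERIV_ident M)
         (use conv[OF x] nw in \<open>simp_all add: norm_mult\<close>)
    also have "2 * of_nat M * (w * x) ^ (2 * M - 1) * (1 + (w * x) * eval_fps (fps_deriv L) (w * x)) * (w * 1)
      = (w ^ (2 * M - 1) * w) * (2 * of_nat M * x ^ (2 * M - 1) * (1 + x * (eval_fps (fps_deriv L) (w * x) * w)))"
      by (simp add: power_mult_distrib algebra_simps)
    also have "w ^ (2 * M - 1) * w = w ^ (2 * M)" using M by (intro power_minus_mult) simp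
    also have "\<dots> = 1" using w by (metis mult.commute power_mult power_one)
    finally show "((\<lambda>x. star_height M L (w * x) - star_height M L x) has_field_derivative 0) (at x within ?B)"
      by (auto intro: has_field_derivative_at_within simp: L'[OF x])
  qed
  then obtain k where k: "\<And>x. x \<in> ?B \<Longrightarrow> star_height M L (w * x) - star_height M L x = k" by blast
  have "0 \<in> ?B" using R(1) norm_ge_zero[of s] by (simp del: norm_ge_zero)
  then have "k = 0" using k[of 0] by simp
  then show ?thesis using k[of s] R(1) by simp
qed

lemma star_param_rotate:
  assumes L: "\<And>n. \<not> M dvd n \<Longrightarrow> fps_nth L n = 0" and w: "w ^ M = 1" and M: "M \<ge> 1"
    and s: "ereal (norm s) < fps_conv_radius L"
  shows "star_param M c L (w * s) = star_param M c L s"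
  by (simp add: star_param_eq star_height_rotate[OF assms] star_radial_rotate[OF L w]
      power_mult_distrib w)

lemma nontrivial_root_of_unity:
  assumes "M \<ge> 2"
  obtains w :: complex where "w ^ M = 1" "w \<noteq> 1"
proof -
  have "card {z::complex. z ^ M = 1} = M" using assms by (intro card_roots_unity_eq) simp
  then have "{z::complex. z ^ M = 1} \<noteq> {1}" using assms by auto
  moreover have "1 \<in> {z::complex. z ^ M = 1}" by simp
  ultimately show ?thesis using that by blast
qed

lemma star_param_not_injective:
  assumes L: "\<And>n. \<not> M dvd n \<Longrightarrow> fps_nth L n = 0" and M: "M \<ge> 2"
    and conv: "fps_conv_radius L > 0"
  shows "\<not> locally_injective (star_param M c L)"
proof
  assume "locally_injective (star_param M c L)"
  then obtain r where r: "r > 0" "inj_on (star_param M c L) (ball 0 r)"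
    unfolding locally_injective_def by blast
  obtain R where R: "R > 0" "\<And>s::complex. norm s < R \<Longrightarrow> ereal (norm s) < fps_conv_radius L"
    by (rule convergent_radius_obtain[OF conv]) (rule that)
  obtain w :: complex where w: "w ^ M = 1" "w \<noteq> 1" by (rule nontrivial_root_of_unity[OF M])
  have nw: "norm w = 1" using power_eq_1_iff[OF w(1)] M by simp
  define s where "s = complex_of_real (min r R / 2)"
  have s: "s \<noteq> 0" "norm s < r" "norm s < R" using r(1) R(1) by (auto simp: s_def min_def)
  have "star_param M c L (w * s) = star_param M c L s"
    using M by (intro star_param_rotate[OF L w(1)] R(2) s) auto
  then have "w * s = s"
    using inj_onD[OF r(2), of "w * s" s] s nw by (auto simp: norm_mult)
  with s w show False by simp
qed

section \<open>Germs of curves as germs of sets\<close>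

lemma isCont_star_param:
  assumes "ereal (norm s) < fps_conv_radius L" "M \<ge> 1"
  shows "isCont (star_param M c L) s"
proof -
  have "isCont (\<lambda>s. (c * star_radial L s ^ M, \<i> * star_height M L s)) s"
    using DERIV_isCont[OF star_radial_deriv[OF assms(1)]] DERIV_isCont[OF star_height_deriv[OF assms]]
    by (intro continuous_intros) auto
  then show ?thesis by (simp add: star_param_eq[abs_def])
qed

lemma star_param_0: "M \<ge> 1 \<Longrightarrow> star_param M c L 0 = (0, 0)"
  by (simp add: star_param_eq)

lemma star_param_tendsto_0:
  assumes "fps_conv_radius L > 0" "M \<ge> 1"
  shows "(star_param M c L \<longlongrightarrow> (0, 0)) (nhds 0)"
  using isCont_star_param[of 0 L M c] assms by (simp add: isCont_def tendsto_nhds_iff star_param_0 zero_ereal_def)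

lemma same_curve_germ_sym:
  assumes "same_curve_germ f g"
  shows "same_curve_germ g f"
proof -
  obtain r where r: "r > 0" "\<And>a b. 0 < a \<Longrightarrow> a \<le> r \<Longrightarrow> 0 < b \<Longrightarrow> b \<le> r \<Longrightarrow>
      \<forall>\<^sub>F p in nhds (0, 0). p \<in> f ` ball 0 a \<longleftrightarrow> p \<in> g ` ball 0 b"
    using assms unfolding same_curve_germ_def by blast
  then show ?thesis
    unfolding same_curve_germ_def by (subst eq_commute) blast
qed

text \<open>The set germ controls points near (0,0), not parameters. Continuity of \<open>f\<close>
  at 0 brings its values into that range; shrinking the second radius to \<open>min r b\<close>
  allows any \<open>b\<close>.\<close>

lemma same_curve_germ_imp:
  assumes germ: "same_curve_germ f g" and lim: "(f \<longlongrightarrow> (0, 0)) (nhds 0)" and b: "b > 0"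
  shows "\<forall>\<^sub>F t in nhds 0. f t \<in> g ` ball 0 b"
proof -
  obtain r where r: "r > 0" "\<And>a b. 0 < a \<Longrightarrow> a \<le> r \<Longrightarrow> 0 < b \<Longrightarrow> b \<le> r \<Longrightarrow>
      \<forall>\<^sub>F p in nhds (0, 0). p \<in> f ` ball 0 a \<longleftrightarrow> p \<in> g ` ball 0 b"
    using germ unfolding same_curve_germ_def by blast
  have "\<forall>\<^sub>F p in nhds (0, 0). p \<in> f ` ball 0 r \<longleftrightarrow> p \<in> g ` ball 0 (min r b)"
    using r(1) b by (intro r(2)) auto
  from eventually_compose_filterlim[OF this lim]
  have "\<forall>\<^sub>F t in nhds 0. f t \<in> f ` ball 0 r \<longleftrightarrow> f t \<in> g ` ball 0 (min r b)" .
  moreover have "\<forall>\<^sub>F t in nhds (0::complex). t \<in> ball 0 r" using r(1) by (intro eventually_nhds_in_open) auto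
  ultimately show ?thesis by eventually_elim auto
qed

text \<open>A point near (0,0) might be the image of a parameter far from 0. Properness forbids
  this, so that comparing small parameters suffices for discs of any radius up to
  \<open>r\<close>.\<close>

lemma same_curve_germI:
  assumes r: "r > 0"
    and f_proper: "\<And>\<delta>. \<delta> > 0 \<Longrightarrow> \<forall>\<^sub>F p in nhds (0, 0). \<forall>t\<in>ball 0 r. f t = p \<longrightarrow> norm t < \<delta>"
    and g_proper: "\<And>\<delta>. \<delta> > 0 \<Longrightarrow> \<forall>\<^sub>F p in nhds (0, 0). \<forall>t\<in>ball 0 r. g t = p \<longrightarrow> norm t < \<delta>"
    and fg: "\<And>b. b > 0 \<Longrightarrow> \<forall>\<^sub>F t in nhds 0. f t \<in> g ` ball 0 b"
    and gf: "\<And>b. b > 0 \<Longrightarrow> \<forall>\<^sub>F t in nhds 0. g t \<in> f ` ball 0 b"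
  shows "same_curve_germ f g"
proof -
  have half: "\<forall>\<^sub>F p in nhds (0, 0). p \<in> f ` ball 0 a \<longrightarrow> p \<in> g ` ball 0 b"
    if a: "a \<le> r" and b: "b > 0"
      and f_proper: "\<And>\<delta>. \<delta> > 0 \<Longrightarrow> \<forall>\<^sub>F p in nhds (0, 0). \<forall>t\<in>ball 0 r. f t = p \<longrightarrow> norm t < \<delta>"
      and fg: "\<And>b. b > 0 \<Longrightarrow> \<forall>\<^sub>F t in nhds 0. f t \<in> g ` ball 0 b"
    for a b and f g :: "complex \<Rightarrow> complex \<times> complex"
  proof -
    obtain \<delta> where \<delta>: "\<delta> > 0" "\<And>t. norm t < \<delta> \<Longrightarrow> f t \<in> g ` ball 0 b"
      using fg[OF b] unfolding eventually_nhds_metric by (auto simp: dist_norm)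
    from f_proper[OF \<delta>(1)] show ?thesis
    proof eventually_elim
      case (elim p)
      show ?case
      proof
        assume "p \<in> f ` ball 0 a"
        then obtain t where t: "t \<in> ball 0 a" "p = f t" by blast
        then have "t \<in> ball 0 r" using a by simp
        with elim t(2) have "norm t < \<delta>" by blast
        with \<delta>(2) t(2) show "p \<in> g ` ball 0 b" by blast
      qed
    qed
  qed
  show ?thesis
    unfolding same_curve_germ_def
  proof (intro exI[of _ r] conjI allI impI r)
    fix a b assume ab: "0 < a \<and> a \<le> r \<and> 0 < b \<and> b \<le> r"
    have "\<forall>\<^sub>F p in nhds (0, 0). p \<in> f ` ball 0 a \<longrightarrow> p \<in> g ` ball 0 b"
      by (rule half[OF _ _ f_proper fg]) (use ab in simp_all)
    moreover have "\<forall>\<^sub>F p in nhds (0, 0). p \<in> g ` ball 0 b \<longrightarrow> p \<in> f ` ball 0 a"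
      by (rule half[OF _ _ g_proper gf]) (use ab in simp_all)
    ultimately show "\<forall>\<^sub>F p in nhds (0, 0). p \<in> f ` ball 0 a \<longleftrightarrow> p \<in> g ` ball 0 b"
      by eventually_elim blast
  qed
qed

lemma eventually_fst_small:
  fixes \<epsilon> :: real
  assumes "\<epsilon> > 0"
  shows "\<forall>\<^sub>F p in nhds (0::complex, 0::complex). norm (fst p) < \<epsilon>"
proof -
  have "open {p :: complex \<times> complex. norm (fst p) < \<epsilon>}"
    by (intro open_Collect_less continuous_intros)
  from eventually_nhds_in_open[OF this, of "(0,0)"] assms show ?thesis by simp
qed

lemma monomial_proper:
  fixes F :: "complex \<Rightarrow> complex"
  assumes "M \<ge> 1" "cmod c = 1" "\<delta> > 0"
  shows "\<forall>\<^sub>F p in nhds (0, 0). \<forall>t\<in>A. (c * t ^ M, F t) = p \<longrightarrow> norm t < \<delta>"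
proof -
  have "\<forall>\<^sub>F p in nhds (0::complex, 0::complex). norm (fst p) < \<delta> ^ M"
    using assms by (intro eventually_fst_small) simp
  then show ?thesis
  proof eventually_elim
    case (elim p)
    show ?case
    proof (intro ballI impI)
      fix t assume "(c * t ^ M, F t) = p"
      then have "norm t ^ M < \<delta> ^ M" using elim assms(2) by (auto simp: norm_mult norm_power)
      then show "norm t < \<delta>" using assms(3) by (meson power_less_imp_less_base less_imp_le)
    qed
  qed
qed

text \<open>The first coordinate has modulus that of T to the power M, so it alone bounds T; the
  local inverse of T then bounds the parameter.\<close>

lemma star_param_proper:
  assumes "fps_conv_radius L > 0" "M \<ge> 1" "cmod c = 1"
  obtains R where "R > 0" "\<And>\<delta>. \<delta> > 0 \<Longrightarrow> \<forall>\<^sub>F p in nhds (0, 0). \<forall>s\<in>ball 0 R. star_param M c L s = p \<longrightarrow> norm s < \<delta>"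
proof (rule star_radial_local_inverse[OF assms(1) zero_less_one], goal_cases)
  case (1 R \<rho> g)
  note inv = this(2-)
  show thesis
  proof (rule 1(1)[OF inv(1)])
    fix \<delta> :: real assume \<delta>: "\<delta> > 0"
    have "isCont g 0" using inv(4,6) by (meson analytic_at analytic_at_imp_isCont centre_in_ball open_ball)
    moreover have "g 0 = 0" using inv(8)[of 0] inv(1) by simp
    ultimately have "\<forall>\<^sub>F q in nhds 0. g q \<in> ball 0 \<delta>"
      using \<delta> by (intro topological_tendstoD[of _ "0::complex"]) (auto simp: isCont_def tendsto_nhds_iff)
    then obtain \<epsilon> where \<epsilon>: "\<epsilon> > 0" "\<And>q. norm q < \<epsilon> \<Longrightarrow> norm (g q) < \<delta>"
      unfolding eventually_nhds_metric by (auto simp: dist_norm)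
    have "\<forall>\<^sub>F p in nhds (0::complex, 0::complex). norm (fst p) < \<epsilon> ^ M"
      using \<epsilon> by (intro eventually_fst_small) simp
    then show "\<forall>\<^sub>F p in nhds (0, 0). \<forall>s\<in>ball 0 R. star_param M c L s = p \<longrightarrow> norm s < \<delta>"
    proof eventually_elim
      case (elim p)
      show ?case
      proof (intro ballI impI)
        fix s :: complex assume s: "s \<in> ball 0 R" "star_param M c L s = p"
        then have "norm (star_radial L s) ^ M < \<epsilon> ^ M"
          using elim assms(3) by (auto simp: star_param_eq norm_mult norm_power)
        then have "norm (star_radial L s) < \<epsilon>" using \<epsilon>(1) by (meson power_less_imp_less_base less_imp_le)
        then show "norm s < \<delta>" using \<epsilon>(2) inv(8)[OF s(1)] by metis
      qed
    qed
  qed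
qed

section \<open>Vanishing order and power series expansions\<close>

text \<open>If the lowest coefficient had index d at most m, F would be t^d times a function bounded
  away from 0, too large for the little-o bound. Half the modulus of that coefficient serves both as
  the lower bound and as the little-o constant.\<close>

lemma smallo_power_imp_coeffs_zero:
  assumes conv: "fps_conv_radius F > 0" and o: "eval_fps F \<in> o[at 0](\<lambda>t. t ^ m)" and n: "n \<le> m"
  shows "fps_nth (F :: complex fps) n = 0"
proof (rule ccontr)
  assume "fps_nth F n \<noteq> 0"
  then have F0: "F \<noteq> 0" and d: "subdegree F \<le> m" using n by (auto intro: order.trans[OF subdegree_leI])
  define d where "d = subdegree F"
  define G where "G = fps_shift d F"
  have G0: "fps_nth G 0 \<noteq> 0" using F0 by (simp add: G_def d_def)
  have "isCont (eval_fps G) 0"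
    using conv by (intro continuous_intros) (auto simp: G_def zero_ereal_def)
  then have lim: "((\<lambda>t. norm (eval_fps G t)) \<longlongrightarrow> norm (fps_nth G 0)) (at 0)"
    by (intro tendsto_norm) (simp add: isCont_def eval_fps_at_0)
  have "\<forall>\<^sub>F t in at 0. norm (fps_nth G 0) / 2 < norm (eval_fps G t)"
    using order_tendstoD(1)[OF lim, of "norm (fps_nth G 0) / 2"] G0 by simp
  moreover have "\<forall>\<^sub>F t in at 0. norm (eval_fps F t) \<le> norm (fps_nth G 0) / 2 * norm (t ^ m)"
    using landau_o.smallD[OF o, of "norm (fps_nth G 0) / 2"] G0 by simp
  moreover have "\<forall>\<^sub>F t in at (0::complex). t \<in> ball 0 1"
    by (intro eventually_at_of_nhds eventually_nhds_in_open) auto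
  moreover have "\<forall>\<^sub>F t in at (0::complex). t \<noteq> 0" by (simp add: eventually_at_filter)
  moreover have "\<forall>\<^sub>F t in at 0. ereal (norm (t::complex)) < fps_conv_radius F"
    by (intro eventually_at_of_nhds eventually_in_disc_of_convergence conv)
  ultimately have "\<forall>\<^sub>F t in at (0::complex). False"
  proof eventually_elim
    case (elim t)
    have "eval_fps (G * fps_X ^ d) t = eval_fps G t * t ^ d"
      using elim(5) by (subst eval_fps_mult) (simp_all add: G_def)
    moreover have "G * fps_X ^ d = F" by (simp add: G_def d_def subdegree_decompose[symmetric])
    ultimately have "eval_fps F t = eval_fps G t * t ^ d" by simp
    then have "norm (eval_fps G t) * norm t ^ d \<le> norm (fps_nth G 0) / 2 * norm t ^ m"
      using elim(2) by (simp add: norm_mult norm_power)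
    also have "\<dots> \<le> norm (fps_nth G 0) / 2 * norm t ^ d"
      using elim(3) d by (intro mult_left_mono power_decreasing) (auto simp: d_def)
    finally have "norm (eval_fps G t) \<le> norm (fps_nth G 0) / 2"
      using elim(4) by simp
    with elim(1) show False by simp
  qed
  then show False by simp
qed

lemma eval_fps_expansion_ball:
  assumes "f holomorphic_on ball 0 r" "s \<in> ball 0 r"
  shows "eval_fps (fps_expansion f 0) s = f s"
  using eval_fps_expansion'[of f 0 "ereal r" s] assms by simp

section \<open>Rotation and loss of injectivity\<close>

text \<open>If \<open>L\<close> is a series in \<open>s\<^bsup>M\<^esup>\<close>, both coordinates of the curve are functions of \<open>t\<^bsup>M\<^esup>\<close>, so that
  rotating \<open>t\<close> by an \<open>M\<close>-th root of unity does not change the point.\<close>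

lemma germ_of_rotation_invariant_not_injective:
  assumes L: "\<And>n. \<not> M dvd n \<Longrightarrow> fps_nth L n = 0" and M: "M \<ge> 2"
    and conv: "fps_conv_radius L > 0" and c: "cmod c = 1"
    and germ: "\<And>b. b > 0 \<Longrightarrow> \<forall>\<^sub>F t in nhds 0. (c * t ^ M, F t) \<in> star_param M c L ` ball 0 b"
  shows "\<not> locally_injective (\<lambda>t. (c * t ^ M, F t))"
proof (rule star_radial_local_inverse[OF conv zero_less_one], rule notI, goal_cases)
  case (1 R \<rho> g)
  note inv = 1(1-9)
  obtain r where r: "r > 0" "inj_on (\<lambda>t. (c * t ^ M, F t)) (ball 0 r)"
    using 1(10) unfolding locally_injective_def by blast
  obtain w :: complex where w: "w ^ M = 1" "w \<noteq> 1" by (rule nontrivial_root_of_unity[OF M])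
  have nw: "norm w = 1" using power_eq_1_iff[OF w(1)] M by simp
  obtain \<delta> where \<delta>: "\<delta> > 0" "\<And>t. norm t < \<delta> \<Longrightarrow> (c * t ^ M, F t) \<in> star_param M c L ` ball 0 R"
    using germ[OF inv(1)] unfolding eventually_nhds_metric by (auto simp: dist_norm)
  define t where "t = complex_of_real (min r \<delta> / 2)"
  have t: "t \<noteq> 0" "norm t < r" "norm t < \<delta>" using r(1) \<delta>(1) by (auto simp: t_def min_def)
  obtain s where s: "s \<in> ball 0 R" "(c * t ^ M, F t) = star_param M c L s"
    using \<delta>(2)[OF t(3)] by blast
  have "norm (w * t) < \<delta>" using t nw by (simp add: norm_mult)
  then obtain s' where s': "s' \<in> ball 0 R" "(c * (w * t) ^ M, F (w * t)) = star_param M c L s'"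
    using \<delta>(2) by blast
  have c0: "c \<noteq> 0" using c by auto
  have T: "star_radial L s ^ M = t ^ M" "star_radial L s' ^ M = t ^ M"
    using s(2) s'(2) c0 w(1) by (auto simp: star_param_eq power_mult_distrib)
  \<comment> \<open>The parameters \<open>t\<close> and \<open>w * t\<close> share the first
    coordinate, so their radial values differ by some M-th root of unity; nothing says that it is
    \<open>w\<close>, but any root leaves \<open>star_param M c L\<close> unchanged.\<close>
  define v where "v = star_radial L s' / star_radial L s"
  have T0: "star_radial L s \<noteq> 0" using T(1) t(1) M by (auto simp: power_0_left)
  have v: "v ^ M = 1" using T T0 t(1) by (simp add: v_def power_divide)
  have nv: "norm v = 1" using power_eq_1_iff[OF v] M by simp
  have "star_radial L s' = star_radial L (v * s)"
    using T0 by (simp add: star_radial_rotate[OF L v]) (simp add: v_def)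
  then have "s' = v * s"
    using inj_onD[OF inv(3), of s' "v * s"] s(1) s'(1) nv by (simp add: norm_mult)
  then have "star_param M c L s' = star_param M c L s"
    using star_param_rotate[OF L v _ inv(5)[OF s(1)]] M by simp
  with s(2) s'(2) have "(c * (w * t) ^ M, F (w * t)) = (c * t ^ M, F t)" by simp
  then have "w * t = t"
    using inj_onD[OF r(2), of "w * t" t] t nw by (simp add: norm_mult)
  with t w show False by simp
qed

section \<open>Intersection with the boundary\<close>

text \<open>The arc is the image of a real interval in the parameter s, where the defect vanishes.
  The components are expanded because \<open>real_curve_near\<close> asks for power series;
  injectivity and nonzero velocity already come from the first one, a multiple of T.\<close>

lemma curve_type_real_curve:
  assumes conv: "L \<in> convergent_series" and ct: "curve_type M L" and c: "cmod c = 1"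
    and germ: "same_curve_germ f (star_param M c L)"
  shows "meets_boundary_in_real_curve f"
proof -
  have conv': "fps_conv_radius L > 0" using conv by (simp add: convergent_series_def)
  have M1: "M = 1" using ct by (simp add: curve_type_def)
  then have M: "M \<ge> 1" by simp
  obtain d where d: "d > 0" "\<And>s. norm s < d \<Longrightarrow> defect M L s = 0 \<longleftrightarrow> Im s = 0"
    using curve_type_defect(2)[OF conv ct] unfolding eventually_nhds_metric by (auto simp: dist_norm)
  obtain r where r: "r > 0" "\<And>a b. 0 < a \<Longrightarrow> a \<le> r \<Longrightarrow> 0 < b \<Longrightarrow> b \<le> r \<Longrightarrow>
      \<forall>\<^sub>F p in nhds (0, 0). p \<in> f ` ball 0 a \<longleftrightarrow> p \<in> star_param M c L ` ball 0 b"
    using germ unfolding same_curve_germ_def by blast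
  obtain R1 where R1: "R1 > 0" "\<And>\<delta>. \<delta> > 0 \<Longrightarrow> \<forall>\<^sub>F p in nhds (0, 0). \<forall>s\<in>ball 0 R1. star_param M c L s = p \<longrightarrow> norm s < \<delta>"
    by (rule star_param_proper[OF conv' M c]) (rule that)
  have "min d R1 > 0" using d R1 by simp
  from conv' this show ?thesis
  proof (rule star_radial_local_inverse, goal_cases)
    case (1 R \<rho> g)
    note inv = this
    define G where "G = fps_expansion (\<lambda>s. c * star_radial L s) 0"
    define H where "H = fps_expansion (\<lambda>s. \<i> * star_height M L s) 0"
    have hT: "star_radial L holomorphic_on ball 0 R" 
      unfolding holomorphic_on_open[OF open_ball] using star_radial_deriv[OF inv(5)] by blast
    have hol: "(\<lambda>s. c * star_radial L s) holomorphic_on ball 0 R"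
      using hT by (intro holomorphic_intros)
    have hP: "star_height M L holomorphic_on ball 0 R"
      unfolding holomorphic_on_open[OF open_ball] using star_height_deriv[OF inv(5) M] by blast
    have hol': "(\<lambda>s. \<i> * star_height M L s) holomorphic_on ball 0 R"
      using hP by (intro holomorphic_intros)
    have cG: "fps_conv_radius G \<ge> ereal R" and cH: "fps_conv_radius H \<ge> ereal R"
      unfolding G_def H_def using hol hol' by (intro conv_radius_fps_expansion; simp)+
    have eG: "eval_fps G s = c * star_radial L s" and eH: "eval_fps H s = \<i> * star_height M L s"
      if "s \<in> ball 0 R" for s
      unfolding G_def H_def by (rule eval_fps_expansion_ball[OF hol that] eval_fps_expansion_ball[OF hol' that])+
    have dT: "deriv (star_radial L) s \<noteq> 0" if "s \<in> ball 0 R" for s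
      using holomorphic_injective_imp_regular[OF hT open_ball inv(3) that] .
    have dG: "eval_fps (fps_deriv G) s \<noteq> 0" if s: "s \<in> ball 0 R" for s
    proof -
      have "(eval_fps G has_field_derivative eval_fps (fps_deriv G) s) (at s)"
        by (intro eval_fps_deriv_at less_le_trans[OF _ cG]) (use s in simp)
      then have "((\<lambda>s. c * star_radial L s) has_field_derivative eval_fps (fps_deriv G) s) (at s)"
        by (rule has_field_derivative_transform_within_open[OF _ open_ball s]) (simp add: eG)
      moreover have "((\<lambda>s. c * star_radial L s) has_field_derivative c * deriv (star_radial L) s) (at s)"
        by (intro DERIV_cmult holomorphic_derivI[OF hT open_ball s])
      ultimately have "eval_fps (fps_deriv G) s = c * deriv (star_radial L) s" by (rule DERIV_unique)
      with dT[OF s] c show ?thesis by auto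
    qed
    define e where "e = R / 2"
    have e: "0 < e" "e < R" "e < d" "e < R1" using inv(1,2) by (auto simp: e_def)
    have inball: "complex_of_real x \<in> ball 0 R" if "x \<in> {-e..e}" for x using that e by auto
    define \<gamma> where "\<gamma> = (\<lambda>x::real. (eval_fps G (of_real x), eval_fps H (of_real x)))"
    have \<gamma>: "\<gamma> x = star_param M c L (of_real x)" if "x \<in> {-e..e}" for x
      using inball[OF that] M1 by (simp add: \<gamma>_def eG eH star_param_eq)
    have inj: "inj_on \<gamma> {-e..e}"
    proof (rule inj_onI)
      fix x y assume x: "x \<in> {-e..e}" and y: "y \<in> {-e..e}" and eq: "\<gamma> x = \<gamma> y"
      have "c * star_radial L (of_real x) = c * star_radial L (of_real y)"
        using eq M1 by (simp add: \<gamma>[OF x] \<gamma>[OF y] star_param_eq)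
      then have "star_radial L (of_real x) = star_radial L (of_real y)" using c by auto
      then have "complex_of_real x = of_real y"
        by (rule inj_onD[OF inv(3) _ inball[OF x] inball[OF y]])
      then show "x = y" by simp
    qed
    have "real_curve_near (f ` ball 0 a \<inter> frontier U2) (0, 0)" if a: "0 < a" "a \<le> r" for a
    proof -
      \<comment> \<open>The arc keeps its fixed interval up to \<open>e\<close>, while the germ
        comparison needs a radius at most \<open>r\<close>. Properness bridges the two: near (0,0)
        only parameters below \<open>b\<close> occur.\<close>
      define b where "b = min e r"
      have b: "0 < b" "b \<le> r" "b \<le> e" using e r by (auto simp: b_def)
      have "\<forall>\<^sub>F q in nhds (0, 0). q \<in> f ` ball 0 a \<inter> frontier U2 \<longleftrightarrow> q \<in> \<gamma> ` {-e..e}"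
        using r(2)[OF a b(1,2)] R1(2)[OF b(1)]
      proof eventually_elim
        case (elim q)
        show ?case
        proof
          assume "q \<in> f ` ball 0 a \<inter> frontier U2"
          then obtain s where s: "norm s < b" "q = star_param M c L s" "q \<in> frontier U2"
            using elim(1) by auto
          then have "Im s = 0" using star_param_in_frontier_iff[OF c] d(2)[of s] b e by auto
          then have "s = of_real (Re s)" by (simp add: complex_eq_iff)
          moreover have "Re s \<in> {-e..e}" using abs_Re_le_cmod[of s] s(1) b by auto
          ultimately show "q \<in> \<gamma> ` {-e..e}" using s(2) \<gamma> by (metis imageI)
        next
          assume "q \<in> \<gamma> ` {-e..e}"
          then obtain x where x: "x \<in> {-e..e}" "q = star_param M c L (of_real x)" using \<gamma> by auto
          have "complex_of_real x \<in> ball 0 R1" using x e by auto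
          then have "norm (complex_of_real x) < b" using elim(2) x(2) by blast
          then have "q \<in> f ` ball 0 a" using elim(1) x(2) by auto
          moreover have "norm (complex_of_real x) < d" using x e by auto
          then have "q \<in> frontier U2" using star_param_in_frontier_iff[OF c] d(2) x(2) by auto
          ultimately show "q \<in> f ` ball 0 a \<inter> frontier U2" by blast
        qed
      qed
      moreover have "\<gamma> 0 = (0, 0)" using \<gamma>[of 0] e M by (simp add: star_param_0)
      moreover have "ereal e < fps_conv_radius G" "ereal e < fps_conv_radius H"
        using e(2) by (auto intro: less_le_trans[OF _ cG] less_le_trans[OF _ cH])
      moreover have "\<forall>x\<in>{-e..e}. (eval_fps (fps_deriv G) (of_real x), eval_fps (fps_deriv H) (of_real x)) \<noteq> (0, 0)"
        using dG inball by auto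
      ultimately show ?thesis
        unfolding real_curve_near_def Let_def using e(1) inj unfolding \<gamma>_def by blast
    qed
    then show ?case unfolding meets_boundary_in_real_curve_def using r(1) by blast
  qed
qed

lemma isolated_type_isolated_point:
  assumes conv: "L \<in> convergent_series" and iso: "isolated_type M L" and c: "cmod c = 1"
    and germ: "\<And>b. b > 0 \<Longrightarrow> \<forall>\<^sub>F t in nhds 0. f t \<in> star_param M c L ` ball 0 b"
    and f0: "f 0 = (0, 0)"
  shows "meets_boundary_in_isolated_point f"
proof -
  have M: "M \<ge> 1" using iso by (simp add: isolated_type_def)
  obtain d where d: "d > 0" "\<And>s. s \<noteq> 0 \<Longrightarrow> norm s < d \<Longrightarrow> defect M L s > 0"
    using isolated_type_defect_pos[OF conv iso] unfolding eventually_at by (auto simp: dist_norm)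
  obtain r where r: "r > 0" "\<And>t. norm t < r \<Longrightarrow> f t \<in> star_param M c L ` ball 0 d"
    using germ[OF d(1)] unfolding eventually_nhds_metric by (auto simp: dist_norm)
  have "f ` ball 0 r \<inter> frontier U2 = {(0, 0)}"
  proof
    show "{(0, 0)} \<subseteq> f ` ball 0 r \<inter> frontier U2"
      using r(1) f0 by (auto simp: frontier_U2 intro!: image_eqI[of _ f 0])
    show "f ` ball 0 r \<inter> frontier U2 \<subseteq> {(0, 0)}"
    proof
      fix p assume p: "p \<in> f ` ball 0 r \<inter> frontier U2"
      then obtain s where s: "norm s < d" "p = star_param M c L s" using r(2) by fastforce
      then have "defect M L s = 0" using p star_param_in_frontier_iff[OF c] by auto
      then have "s = 0" using d(2)[of s] s(1) by force
      then show "p \<in> {(0, 0)}" using s(2) star_param_0[OF M] by simp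
    qed
  qed
  then show ?thesis unfolding meets_boundary_in_isolated_point_def using r(1) by blast
qed

section \<open>Existence of the normalized parametrization\<close>

text \<open>The parameter \<open>s\<close> is dictated by the relation \<open>2 M i s\<^bsup>2M\<^esup> = t \<phi>'(t)\<close>, and then
  \<open>L = log (t / s)\<close>.\<close>

lemma exists_star_reparametrization:
  assumes M: "M \<ge> 1" and conv: "fps_conv_radius \<phi> > 0"
    and low: "\<And>n. n < 2 * M \<Longrightarrow> fps_nth \<phi> n = 0" and lead: "fps_nth \<phi> (2 * M) = \<i>"
  obtains L S where "L \<in> convergent_series" "fps_nth L 0 = 0"
    "\<forall>\<^sub>F s in nhds 0. star_param M c L s = (c * star_radial L s ^ M, eval_fps \<phi> (star_radial L s))"
    "\<forall>\<^sub>F t in nhds 0. star_radial L (S t) = t" "isCont S 0" "S 0 = 0"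
proof -
  \<comment> \<open>\<open>B\<close> is the quotient t phi'(t) / t^(2M), with value 2M i at 0;
    dividing by that constant normalizes \<open>k\<close> to 1 at 0.\<close>
  define B where "B = fps_shift (2 * M) (fps_X * fps_deriv \<phi>)"
  define k where "k t = eval_fps B t / (2 * of_nat M * \<i>)" for t
  have convd: "fps_conv_radius (fps_X * fps_deriv \<phi>) \<ge> fps_conv_radius \<phi>"
    using order.trans[OF _ fps_conv_radius_mult[of fps_X "fps_deriv \<phi>"]] fps_conv_radius_deriv[of \<phi>] by simp
  then have convB: "fps_conv_radius B \<ge> fps_conv_radius \<phi>" by (simp add: B_def)
  have "fps_nth (fps_X * fps_deriv \<phi>) n = of_nat n * fps_nth \<phi> n" for n by (cases n) simp_all
  then have BX: "fps_X * fps_deriv \<phi> = B * fps_X ^ (2 * M)" and B0: "fps_nth B 0 = 2 * of_nat M * \<i>"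
    using low lead by (auto simp: fps_eq_iff B_def fps_X_power_mult_right_nth)
  have tk: "t * eval_fps (fps_deriv \<phi>) t = 2 * of_nat M * \<i> * (t ^ (2 * M) * k t)"
    if "ereal (norm t) < fps_conv_radius \<phi>" for t
  proof -
    have "eval_fps (fps_X * fps_deriv \<phi>) t = t * eval_fps (fps_deriv \<phi>) t"
      using less_le_trans[OF that fps_conv_radius_deriv] by (subst eval_fps_mult) auto
    moreover have "eval_fps (B * fps_X ^ (2 * M)) t = eval_fps B t * t ^ (2 * M)"
      using less_le_trans[OF that convB] by (subst eval_fps_mult) auto
    ultimately show ?thesis using BX M by (simp add: k_def mult.commute)
  qed
  have "0 < fps_conv_radius B" using conv convB by (rule less_le_trans)
  then have "isCont k 0"
    unfolding k_def by (intro continuous_intros) (use M in \<open>auto simp: zero_ereal_def\<close>)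
  moreover have k0: "k 0 = 1" using M B0 by (simp add: k_def eval_fps_at_0)
  ultimately have "\<forall>\<^sub>F t in nhds 0. k t \<in> {z. Re z > 0}"
    by (intro topological_tendstoD[of _ "1::complex"] open_halfspace_Re_gt)
       (auto simp: isCont_def tendsto_nhds_iff)
  then have "\<forall>\<^sub>F t in nhds 0. Re (k t) > 0 \<and> ereal (norm t) < fps_conv_radius \<phi>"
    using eventually_in_disc_of_convergence[OF conv] by eventually_elim simp
  then obtain R0 where R0: "R0 > 0" "\<And>t. norm t < R0 \<Longrightarrow> Re (k t) > 0"
     "\<And>t::complex. norm t < R0 \<Longrightarrow> ereal (norm t) < fps_conv_radius \<phi>"
    unfolding eventually_nhds_metric by (auto simp: dist_norm)
  \<comment> \<open>\<open>S\<close> is t times the 2M-th root of \<open>k\<close>, hence s^(2M) =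
    t^(2M) k(t). Positive real part keeps \<open>k\<close> off the cut of \<open>Ln\<close>, and
    \<open>k 0 = 1\<close> gives \<open>l 0 = 0\<close>, hence L(0) = 0.\<close>
  define l where "l t = Ln (k t) / (2 * of_nat M)" for t
  define S where "S t = t * exp (l t)" for t
  have subB: "ball (0::complex) R0 \<subseteq> eball 0 (fps_conv_radius B)"
    using less_le_trans[OF R0(3) convB] by auto
  have hk: "k holomorphic_on ball 0 R0"
    unfolding k_def by (intro holomorphic_intros subB) (use M in auto)
  have hl: "l holomorphic_on ball 0 R0"
    unfolding l_def
    by (intro holomorphic_intros hk) (use M R0(2) in \<open>auto simp: complex_nonpos_Reals_iff not_le\<close>)
  have hS: "S holomorphic_on ball 0 R0" unfolding S_def by (intro holomorphic_intros hl)
  have l0: "l 0 = 0" by (simp add: l_def k0)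
  have S0: "S 0 = 0" by (simp add: S_def)
  have Spow: "S t ^ (2 * M) = t ^ (2 * M) * k t" if "norm t < R0" for t
  proof -
    have "k t \<noteq> 0" using R0(2)[OF that] by auto
    have "exp (l t) ^ (2 * M) = exp (of_nat (2 * M) * l t)" by (simp only: exp_of_nat_mult)
    also have "of_nat (2 * M) * l t = Ln (k t)" using M by (simp add: l_def)
    finally show ?thesis using \<open>k t \<noteq> 0\<close> by (simp add: S_def power_mult_distrib)
  qed
  have "(S has_field_derivative 1 * exp (l 0) + exp (l 0) * deriv l 0 * 0) (at 0)"
    unfolding S_def
    by (intro DERIV_mult DERIV_ident DERIV_chain2[OF DERIV_exp] holomorphic_derivI[OF hl open_ball]) (simp add: R0)
  then have dS: "deriv S 0 \<noteq> 0" by (simp add: DERIV_imp_deriv l0)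
  show ?thesis
  proof (rule holomorphic_local_inverse[OF hS R0(1) S0 dS], goal_cases)
    case (1 R \<rho> g)
    note inv = this
    have g0: "g 0 = 0" using inv(7)[of 0] inv(1) S0 by simp
    have gR: "norm (g s) < R0" if "s \<in> ball 0 \<rho>" for s using inv(6)[OF that] inv(2) by auto
    \<comment> \<open>Since s = t exp (l t), the inverse \<open>g\<close> of \<open>S\<close>
      satisfies g s = s exp (- l (g s)), so this choice makes \<open>star_radial L\<close> equal to
      \<open>g\<close>.\<close>
    define L where "L = fps_expansion (\<lambda>s. - l (g s)) 0"
    have hL: "(\<lambda>s. - l (g s)) holomorphic_on ball 0 \<rho>"
      by (intro holomorphic_intros holomorphic_on_compose_gen[OF inv(5) hl, unfolded o_def])
         (use gR in auto)
    have cL: "fps_conv_radius L \<ge> ereal \<rho>"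
      unfolding L_def using hL by (intro conv_radius_fps_expansion) simp
    have eL: "eval_fps L s = - l (g s)" if "s \<in> ball 0 \<rho>" for s
      unfolding L_def by (rule eval_fps_expansion_ball[OF hL that])
    have cLs: "ereal (norm s) < fps_conv_radius L" if "s \<in> ball 0 \<rho>" for s
      by (rule less_le_trans[OF _ cL]) (use that in simp)
    have rad: "star_radial L s = g s" if s: "s \<in> ball 0 \<rho>" for s
    proof -
      have "g s * exp (l (g s)) = s" using inv(6)[OF s] by (simp add: S_def)
      then have "s * exp (- l (g s)) = g s" by (metis exp_minus_inverse mult.assoc mult.right_neutral)
      then show ?thesis by (simp add: star_radial_def eL[OF s])
    qed
    have conv_L: "L \<in> convergent_series"
      using inv(4) cL by (auto simp: convergent_series_def intro: less_le_trans[of _ "ereal \<rho>"])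
    have L0: "fps_nth L 0 = 0" using eL[of 0] inv(4) by (simp add: eval_fps_at_0 g0 l0)
    have "\<exists>d. \<forall>s\<in>ball 0 \<rho>. \<i> * star_height M L s - eval_fps \<phi> (star_radial L s) = d"
    proof (rule has_field_derivative_zero_constant)
      fix s :: complex assume s: "s \<in> ball 0 \<rho>"
      let ?t = "star_radial L s" and ?u = "1 + s * eval_fps (fps_deriv L) s"
      have tR: "norm ?t < R0" using gR[OF s] by (simp add: rad[OF s])
      have sS: "s = S ?t" using inv(6)[OF s] by (simp add: rad[OF s])
      let ?D = "\<i> * (2 * of_nat M * s ^ (2 * M - 1) * ?u) - eval_fps (fps_deriv \<phi>) ?t * (exp (eval_fps L s) * ?u)"
      have "((\<lambda>s. \<i> * star_height M L s - eval_fps \<phi> (star_radial L s)) has_field_derivative ?D) (at s)"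
        by (intro DERIV_diff DERIV_cmult star_height_deriv M cLs[OF s]
            DERIV_chain2[where f = "eval_fps \<phi>"] eval_fps_deriv_at star_radial_deriv R0(3) tR)
      also have "?D = 0"
      \<comment> \<open>The relation for s^(2M) involves s phi-derivatives, so equality is obtained
        after multiplying by s; at s = 0 both terms vanish separately, the second because phi has no
        linear term.\<close>
      proof (cases "s = 0")
        case True
        have "fps_nth \<phi> 1 = 0" using low M by simp
        then show ?thesis using True M by (simp add: eval_fps_at_0 power_0_left)
      next
        case False
        have "s * (\<i> * (2 * of_nat M * s ^ (2 * M - 1) * ?u)) = 2 * of_nat M * \<i> * (s ^ (2 * M - 1) * s) * ?u"
          by (simp only: mult_ac)
        also have "s ^ (2 * M - 1) * s = s ^ (2 * M)" using M by (intro power_minus_mult) simp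
        also have "s ^ (2 * M) = ?t ^ (2 * M) * k ?t" using Spow[OF tR] sS by simp
        also have "2 * of_nat M * \<i> * (?t ^ (2 * M) * k ?t) = ?t * eval_fps (fps_deriv \<phi>) ?t"
          using tk[OF R0(3)[OF tR]] by simp
        also have "?t * eval_fps (fps_deriv \<phi>) ?t * ?u = s * (eval_fps (fps_deriv \<phi>) ?t * (exp (eval_fps L s) * ?u))"
          by (simp add: star_radial_def mult_ac)
        finally show ?thesis using False by simp
      qed
      finally show "((\<lambda>s. \<i> * star_height M L s - eval_fps \<phi> (star_radial L s)) has_field_derivative 0) (at s within ball 0 \<rho>)"
        by (rule has_field_derivative_at_within)
    qed simp
    then obtain d where d: "\<And>s. s \<in> ball 0 \<rho> \<Longrightarrow> \<i> * star_height M L s - eval_fps \<phi> (star_radial L s) = d" by blast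
    have "d = 0" using d[of 0] inv(4) low[of 0] M by (simp add: eval_fps_at_0)
    show ?case
    proof (rule that[OF conv_L L0, of S])
      show "\<forall>\<^sub>F s in nhds 0. star_param M c L s = (c * star_radial L s ^ M, eval_fps \<phi> (star_radial L s))"
        using eventually_nhds_in_open[of "ball 0 \<rho>" "0::complex"] inv(4) d \<open>d = 0\<close>
        by (auto elim!: eventually_mono simp: star_param_eq)
      have contS: "isCont S 0"
        using hS R0(1) by (meson analytic_at analytic_at_imp_isCont centre_in_ball open_ball)
      then show "isCont S 0" .
      have "\<forall>\<^sub>F t in nhds 0. S t \<in> ball 0 \<rho>"
        using contS S0 inv(4) by (intro topological_tendstoD[of _ "0::complex"]) (auto simp: isCont_def tendsto_nhds_iff)
      moreover have "\<forall>\<^sub>F t in nhds (0::complex). t \<in> ball 0 R"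
        using inv(1) by (intro eventually_nhds_in_open) auto
      ultimately show "\<forall>\<^sub>F t in nhds 0. star_radial L (S t) = t"
        by eventually_elim (simp add: rad inv(7))
    qed (rule S0)
  qed
qed

text \<open>\<open>star_radial L\<close> sends small s to small t and \<open>S\<close> sends small t
  back to small s; each supplies one inclusion of images. The first coordinates supply
  properness.\<close>

lemma reparametrization_same_germ:
  assumes M: "M \<ge> 1" and c: "cmod c = 1" and conv: "fps_conv_radius L > 0"
    and eq: "\<forall>\<^sub>F s in nhds 0. star_param M c L s = (c * star_radial L s ^ M, F (star_radial L s))"
    and inv: "\<forall>\<^sub>F t in nhds 0. star_radial L (S t) = t" and S: "isCont S 0" "S 0 = 0"
  shows "same_curve_germ (\<lambda>t. (c * t ^ M, F t)) (star_param M c L)"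
proof -
  obtain R where R: "R > 0" "\<And>\<delta>. \<delta> > 0 \<Longrightarrow> \<forall>\<^sub>F p in nhds (0, 0). \<forall>s\<in>ball 0 R. star_param M c L s = p \<longrightarrow> norm s < \<delta>"
    by (rule star_param_proper[OF conv M c]) (rule that)
  show ?thesis
  proof (rule same_curve_germI[OF R(1)])
    fix b :: real assume b: "b > 0"
    have S_lim: "filterlim S (nhds 0) (nhds 0)"
      using S by (simp add: isCont_def tendsto_nhds_iff)
    have "\<forall>\<^sub>F s in nhds (0::complex). s \<in> ball 0 b" using b by (intro eventually_nhds_in_open) auto
    with eq have "\<forall>\<^sub>F s in nhds 0. star_param M c L s = (c * star_radial L s ^ M, F (star_radial L s)) \<and> s \<in> ball 0 b"
      by (rule eventually_conj)
    from eventually_compose_filterlim[OF this S_lim] inv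
    show "\<forall>\<^sub>F t in nhds 0. (c * t ^ M, F t) \<in> star_param M c L ` ball 0 b"
    proof eventually_elim
      case (elim t)
      then show ?case by (intro image_eqI[of _ _ "S t"]) auto
    qed
    have "isCont (star_radial L) 0"
      using star_radial_deriv[of 0 L] conv DERIV_isCont by (auto simp: zero_ereal_def)
    then have "\<forall>\<^sub>F s in nhds 0. star_radial L s \<in> ball 0 b"
      using b by (intro topological_tendstoD[of _ "0::complex"]) (auto simp: isCont_def tendsto_nhds_iff)
    with eq show "\<forall>\<^sub>F s in nhds 0. star_param M c L s \<in> (\<lambda>t. (c * t ^ M, F t)) ` ball 0 b"
    proof eventually_elim
      case (elim s)
      then show ?case by (intro image_eqI[of _ _ "star_radial L s"]) auto
    qed
  next
    fix \<delta> :: real assume "\<delta> > 0"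
    then show "\<forall>\<^sub>F p in nhds (0, 0). \<forall>t\<in>ball 0 R. (c * t ^ M, F t) = p \<longrightarrow> norm t < \<delta>"
      by (rule monomial_proper[OF M c])
    show "\<forall>\<^sub>F p in nhds (0, 0). \<forall>t\<in>ball 0 R. star_param M c L t = p \<longrightarrow> norm t < \<delta>"
      by (rule R(2)) fact
  qed
qed

section \<open>Dichotomy and conclusion\<close>

lemma coeffs_of_leading_term:
  assumes "fps_conv_radius \<phi> > 0"
    and "(\<lambda>t. eval_fps \<phi> t - a * t ^ m) \<in> o[at 0](\<lambda>t. t ^ m)"
  shows "\<And>n. n < m \<Longrightarrow> fps_nth (\<phi> :: complex fps) n = 0" "fps_nth \<phi> m = a"
proof -
  define F where "F = \<phi> - fps_const a * fps_X ^ m"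
  have cX: "fps_conv_radius (fps_const a * fps_X ^ m) = \<infinity>"
    using fps_conv_radius_mult[of "fps_const a" "fps_X ^ m"] by (simp add: top_ereal_def[symmetric] top.extremum_unique)
  have cF: "fps_conv_radius F > 0"
    using assms(1) fps_conv_radius_diff[of \<phi> "fps_const a * fps_X ^ m"]
    by (simp add: F_def cX less_le_trans)
  have "\<forall>\<^sub>F t in at 0. eval_fps F t = eval_fps \<phi> t - a * t ^ m"
    using eventually_at_of_nhds[OF eventually_in_disc_of_convergence[OF assms(1)]]
  proof eventually_elim
    case (elim t)
    have "eval_fps (fps_const a * fps_X ^ m) t = a * t ^ m"
      by (subst eval_fps_mult) auto
    with elim cX show ?case by (simp add: F_def eval_fps_diff)
  qed
  then have "eval_fps F \<in> o[at 0](\<lambda>t. t ^ m)"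
    using assms(2) by (subst landau_o.small.in_cong)
  then have "fps_nth F n = 0" if "n \<le> m" for n
    using smallo_power_imp_coeffs_zero[OF cF _ that] by blast
  then show "\<And>n. n < m \<Longrightarrow> fps_nth \<phi> n = 0" "fps_nth \<phi> m = a"
    by (force simp: F_def fps_X_power_nth)+
qed

lemma avoids_U2_star_param_iff:
  assumes "cmod c = 1"
  shows "avoids_U2 (star_param M c L) \<longleftrightarrow> (\<forall>\<^sub>F s in nhds 0. defect M L s \<ge> 0)"
  by (simp add: avoids_U2_def star_param_notin_U2_iff[OF assms])

text \<open>The coefficient at \<open>2 * M * K\<close> would have real part both zero and
  positive.\<close>

lemma curve_type_not_isolated_type:
  assumes "curve_type M L" "isolated_type M L"
  shows False
  using assms(2)
  by (rule isolated_type_coeffs) (use assms(1) in \<open>simp add: curve_type_def imaginary_series_def\<close>)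

text \<open>\<open>L\<close> is any series whose curve has the same set germ as \<open>f\<close>,
  not only the constructed one. Avoiding \<open>U2\<close> is a property of the image, so it passes
  to \<open>star_param M c L\<close>; the inequality of the two truth values expresses that exactly
  one type occurs.\<close>

lemma same_germ_dichotomy:
  fixes M :: nat and c :: complex and F :: "complex \<Rightarrow> complex"
  defines "f \<equiv> (\<lambda>t. (c * t ^ M, F t))"
  assumes M: "M \<ge> 1" and c: "cmod c = 1" and F: "isCont F 0" "F 0 = 0"
    and inj: "locally_injective f" and avoids: "avoids_U2 f"
    and L: "L \<in> convergent_series" "fps_nth L 0 = 0"
    and germ: "same_curve_germ f (star_param M c L)"
  shows "curve_type M L \<noteq> isolated_type M L"
    "curve_type M L \<Longrightarrow> meets_boundary_in_real_curve f"
    "isolated_type M L \<Longrightarrow> meets_boundary_in_isolated_point f"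
proof -
  have conv: "fps_conv_radius L > 0" using L by (simp add: convergent_series_def)
  have f0: "f 0 = (0, 0)" using M F by (simp add: f_def)
  have "isCont f 0" unfolding f_def by (intro continuous_intros F)
  then have lim: "(f \<longlongrightarrow> (0, 0)) (nhds 0)" by (simp add: isCont_def tendsto_nhds_iff f0)
  note f_in = same_curve_germ_imp[OF germ lim]
  obtain r where r: "r > 0" "\<And>t. norm t < r \<Longrightarrow> f t \<notin> U2"
    using avoids unfolding avoids_U2_def eventually_nhds_metric by (auto simp: dist_norm)
  have "\<forall>\<^sub>F s in nhds 0. star_param M c L s \<in> f ` ball 0 r"
    by (rule same_curve_germ_imp[OF same_curve_germ_sym[OF germ] star_param_tendsto_0[OF conv M] r(1)])
  then have "\<forall>\<^sub>F s in nhds 0. defect M L s \<ge> 0"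
  proof eventually_elim
    case (elim s)
    then have "star_param M c L s \<notin> U2" using r(2) by auto
    then show ?case by (simp add: star_param_notin_U2_iff[OF c])
  qed
  from nonneg_defect_coeffs[OF L(1) M L(2) this] have "curve_type M L \<or> isolated_type M L"
  proof
    assume coeffs: "\<forall>n. Re (fps_nth L n) = 0 \<and> (\<not> M dvd n \<longrightarrow> fps_nth L n = 0)"
    \<comment> \<open>Injectivity is given for \<open>f\<close> and not for
      \<open>star_param M c L\<close>, so the rotation argument has to run through the germ.\<close>
    have "\<not> M \<ge> 2"
      using germ_of_rotation_invariant_not_injective[OF _ _ conv c, of M F] f_in inj coeffs
      unfolding f_def by blast
    then have "M = 1" using M by simp
    with coeffs L show ?thesis by (simp add: curve_type_def imaginary_series_def)
  qed simp
  then show "curve_type M L \<noteq> isolated_type M L" using curve_type_not_isolated_type by blast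
  show "meets_boundary_in_real_curve f" if "curve_type M L"
    by (rule curve_type_real_curve[OF L(1) that c germ])
  show "meets_boundary_in_isolated_point f" if "isolated_type M L"
    by (rule isolated_type_isolated_point[OF L(1) that c f_in f0])
qed

theorem theorem1p5:
  fixes M :: nat and c :: complex
  assumes "M \<ge> 1" and "cmod c = 1"
  shows
    "(\<forall>\<phi> \<in> convergent_series.
        (\<lambda>t. eval_fps \<phi> t - \<i> * t ^ (2 * M)) \<in> o[at 0](\<lambda>t. t ^ (2 * M)) \<and>
        locally_injective (\<lambda>t. (c * t ^ M, eval_fps \<phi> t)) \<and>
        avoids_U2 (\<lambda>t. (c * t ^ M, eval_fps \<phi> t)) \<longrightarrow>
          (\<exists>L \<in> convergent_series. fps_nth L 0 = 0 \<and>
             same_curve_germ (\<lambda>t. (c * t ^ M, eval_fps \<phi> t)) (star_param M c L)) \<and>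
          (\<forall>L \<in> convergent_series. fps_nth L 0 = 0 \<and>
             same_curve_germ (\<lambda>t. (c * t ^ M, eval_fps \<phi> t)) (star_param M c L) \<longrightarrow>
               (curve_type M L \<noteq> isolated_type M L) \<and>
               (curve_type M L \<longrightarrow>
                  meets_boundary_in_real_curve (\<lambda>t. (c * t ^ M, eval_fps \<phi> t))) \<and>
               (isolated_type M L \<longrightarrow>
                  meets_boundary_in_isolated_point (\<lambda>t. (c * t ^ M, eval_fps \<phi> t)))))
     \<and>
     (\<forall>L \<in> convergent_series.
        fps_nth L 0 = 0 \<and> (curve_type M L \<or> isolated_type M L) \<longrightarrow>
          avoids_U2 (star_param M c L) \<and>
          (M \<ge> 2 \<and> locally_injective (star_param M c L) \<longrightarrow>
             \<not> (\<exists>Lt \<in> convergent_series. L = Lt oo fps_X ^ M)))"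
proof (intro conjI ballI impI; (elim conjE)?)
  fix \<phi> assume "\<phi> \<in> convergent_series"
    and o: "(\<lambda>t. eval_fps \<phi> t - \<i> * t ^ (2 * M)) \<in> o[at 0](\<lambda>t. t ^ (2 * M))"
  then have conv: "fps_conv_radius \<phi> > 0" by (simp add: convergent_series_def)
  note coeffs = coeffs_of_leading_term[OF conv o]
  show "\<exists>L \<in> convergent_series. fps_nth L 0 = 0 \<and>
             same_curve_germ (\<lambda>t. (c * t ^ M, eval_fps \<phi> t)) (star_param M c L)"
  proof (rule exists_star_reparametrization[OF assms(1) conv coeffs])
    fix L S
    assume L: "L \<in> convergent_series" "fps_nth L 0 = 0"
      and eq: "\<forall>\<^sub>F s in nhds 0. star_param M c L s = (c * star_radial L s ^ M, eval_fps \<phi> (star_radial L s))"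
      and S: "\<forall>\<^sub>F t in nhds 0. star_radial L (S t) = t" "isCont S 0" "S 0 = 0"
    then have "fps_conv_radius L > 0" by (simp add: convergent_series_def)
    from reparametrization_same_germ[OF assms this eq S] L show ?thesis by blast
  qed
next
  fix \<phi> L
  assume "\<phi> \<in> convergent_series"
    and o: "(\<lambda>t. eval_fps \<phi> t - \<i> * t ^ (2 * M)) \<in> o[at 0](\<lambda>t. t ^ (2 * M))"
    and f: "locally_injective (\<lambda>t. (c * t ^ M, eval_fps \<phi> t))" "avoids_U2 (\<lambda>t. (c * t ^ M, eval_fps \<phi> t))"
    and L: "L \<in> convergent_series" "fps_nth L 0 = 0"
      "same_curve_germ (\<lambda>t. (c * t ^ M, eval_fps \<phi> t)) (star_param M c L)"
  then have conv: "fps_conv_radius \<phi> > 0" by (simp add: convergent_series_def)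
  have "fps_nth \<phi> 0 = 0" using coeffs_of_leading_term(1)[OF conv o, of 0] assms(1) by simp
  then have \<phi>0: "eval_fps \<phi> 0 = 0" by (simp add: eval_fps_at_0)
  have "isCont (eval_fps \<phi>) 0" using conv by (intro continuous_intros) (auto simp: zero_ereal_def)
  note dichotomy = same_germ_dichotomy[OF assms this \<phi>0 f L]
  show "curve_type M L \<noteq> isolated_type M L" by (fact dichotomy)
  show "curve_type M L \<Longrightarrow> meets_boundary_in_real_curve (\<lambda>t. (c * t ^ M, eval_fps \<phi> t))"
    by (fact dichotomy)
  show "isolated_type M L \<Longrightarrow> meets_boundary_in_isolated_point (\<lambda>t. (c * t ^ M, eval_fps \<phi> t))"
    by (fact dichotomy)
next
  fix L
  assume L: "L \<in> convergent_series" "curve_type M L \<or> isolated_type M L"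
  have "\<forall>\<^sub>F s in nhds 0. defect M L s \<ge> 0"
  proof (cases "curve_type M L")
    case True
    then show ?thesis by (rule curve_type_defect(1)[OF L(1)])
  next
    case False
    then have "\<forall>\<^sub>F s in at 0. defect M L s > 0" using isolated_type_defect_pos L by blast
    moreover have "defect M L 0 = 0" using assms(1) by (simp add: defect_def)
    ultimately show ?thesis
      unfolding eventually_at_filter by (auto elim!: eventually_mono)
  qed
  then show "avoids_U2 (star_param M c L)" by (simp add: avoids_U2_star_param_iff[OF assms(2)])
next
  fix L
  assume L: "L \<in> convergent_series" and M: "M \<ge> 2" and inj: "locally_injective (star_param M c L)"
  show "\<not> (\<exists>Lt \<in> convergent_series. L = Lt oo fps_X ^ M)"
  proof
    assume "\<exists>Lt \<in> convergent_series. L = Lt oo fps_X ^ M"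
    then have "\<And>n. \<not> M dvd n \<Longrightarrow> fps_nth L n = 0"
      using assms(1) by (auto simp: fps_nth_compose_X_power)
    from star_param_not_injective[OF this M] L inj show False by (simp add: convergent_series_def)
  qed
qed

end
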